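(* Let the data, spaces and forms be as described in the context, and assume that the potential energy density $W$ is a $C^1$ convex function. Let $\Delta t=T/N>0$ and let $(\mathbf u^n)_{n=0}^N\subset (H^1_0(\Omega))^d$ and $(\mathbf X^n)_{n=0}^N\subset (H^1(\mathcal B))^d$, together with $p^n\in L^2_0(\Omega)$ and $\boldsymbol\lambda^n\in\Lambda$ for $n=1,\dots,N$, satisfy the following time-discrete problem: $\mathbf u^0=\mathbf u_0$, $\mathbf X^0=\mathbf X_0$ and, for every $n=0,\dots,N-1$, $$\rho_f\Big(\frac{\mathbf u^{n+1}-\mathbf u^n}{\Delta t},\mathbf v\Big)+b(\mathbf u^n,\mathbf u^{n+1},\mathbf v)+a(\mathbf u^{n+1},\mathbf v)-(\operatorname{div}\mathbf v,p^{n+1})+\mathbf c_1(\boldsymbol\lambda^{n+1},\mathbf v(\mathbf X^n))=0\quad\forall \mathbf v\in(H^1_0(\Omega))^d,$$ $$(\operatorname{div}\mathbf u^{n+1},q)=0\quad\forall q\in L^2_0(\Omega),$$ $$\delta\rho\Big(\frac{\mathbf X^{n+1}-2\mathbf X^n+\mathbf X^{n-1}}{\Delta t^2},\mathbf Y\Big)_{\mathcal B}+(\mathbb P(\mathbb F^{n+1}),\nabla_s\mathbf Y)_{\mathcal B}-\mathbf c_2(\boldsymbol\lambda^{n+1},\mathbf Y)=0\quad\forall\mathbf Y\in(H^1(\mathcal B))^d,$$ $$\mathbf c_1(\boldsymbol\mu,\mathbf u^{n+1}(\mathbf X^n))-\mathbf c_2\Big(\boldsymbol\mu,\frac{\mathbf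 X^{n+1}-\mathbf X^n}{\Delta t}\Big)=0\quad\forall\boldsymbol\mu\in\Lambda,$$ where $\mathbb F^{n}=\nabla_s\mathbf X^{n}$. Assume moreover that $\mathbf X^n\in (W^{1,\infty}(\mathcal B))^d$ for all $n=0,\dots,N$. Then, with no restriction on $\Delta t$, for all $n=0,\dots,N-1$, $$\frac{\rho_f}{2\Delta t}\big(\|\mathbf u^{n+1}\|_0^2-\|\mathbf u^n\|_0^2\big)+\nu\|\boldsymbol\nabla_{\rm sym}\mathbf u^{n+1}\|_0^2+\frac{\delta\rho}{2\Delta t}\Big(\Big\|\frac{\mathbf X^{n+1}-\mathbf X^n}{\Delta t}\Big\|_{0,\mathcal B}^2-\Big\|\frac{\mathbf X^n-\mathbf X^{n-1}}{\Delta t}\Big\|_{0,\mathcal B}^2\Big)+\frac{E(\mathbf X^{n+1})-E(\mathbf X^n)}{\Delta t}\le 0.$$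
   Context: $\Omega\subset\mathbb R^d$, $d\in\{2,3\}$, is a bounded domain with Lipschitz boundary (containing fluid and structure); $\mathcal B\subset\mathbb R^m$ is the bounded reference domain of the structure, with $m=d$ (thick structure) or $m=d-1$ (thin structure). $(\cdot,\cdot)$ and $\|\cdot\|_0$ are the $L^2(\Omega)$ scalar product and norm, $(\cdot,\cdot)_{\mathcal B}$ and $\|\cdot\|_{0,\mathcal B}$ those of $L^2(\mathcal B)$ (vector- or tensor-valued, with $\mathbb D:\mathbb E=\sum_{\alpha,i}\mathbb D_{\alpha i}\mathbb E_{\alpha i}$). $L^2_0(\Omega)$ is the space of $L^2(\Omega)$ functions with zero mean. $\nabla_s$ is the gradient on $\mathcal B$. $T>0$ is the final time and $N$ the number of time steps. Constants: $\rho_f>0$ (fluid density), $\nu>0$ (viscosity), $\delta\rho\ge 0$ (excess density of the structure). Forms: $\boldsymbol\nabla_{\rm sym}\mathbf u=\nabla\mathbf u+(\nabla\mathbf u)^\top$, $a(\mathbf u,\mathbf v)=\nu(\boldsymbol\nabla_{\rm sym}\mathbf u,\boldsymbol\nabla_{\rm sym}\mathbf v)$, $b(\mathbf u,\mathbf v,\mathbf w)=\frac{\rho_f}{2}\big((\mathbf u\cdot\nabla\mathbf v,\mathbf w)-(\mathbf u\cdot\nabla\mathbf w,\mathbf v)\big)$. Elasticity: $W:\mathbb R^{d\times m}\to\mathbb R$ is a positive energy density, $\mathbb P(\mathbb F)=\partial W/\partial\mathbb F(\mathbb F)$, i.e. $\mathbb P_{\alpha i}=\partial W/\partial\mathbb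 F_{\alpha i}$, is the first Piola–Kirchhoff stress tensor, and $E(\mathbf X)=\int_{\mathcal B}W(\nabla_s\mathbf X(\mathbf s))\,d\mathbf s$ is the elastic potential energy. Multiplier space and coupling forms: $\Lambda$, $M_1$, $M_2$ are function spaces and $\mathbf c_1:\Lambda\times M_1\to\mathbb R$, $\mathbf c_2:\Lambda\times M_2\to\mathbb R$ are bilinear forms such that $\mathbf c_1(\boldsymbol\mu,\mathbf Z)-\mathbf c_2(\boldsymbol\mu,\mathbf Y)=0$ for all $\boldsymbol\mu\in\Lambda$ implies $\mathbf Z=\mathbf Y$ in $\mathcal B$. The choices are: for $m=d$, $M_1=M_2=(H^1(\mathcal B))^d$ and either $\Lambda=((H^1(\mathcal B))^d)'$ with $\mathbf c_1=\mathbf c_2$ the duality pairing, or $\Lambda=(H^1(\mathcal B))^d$ with $\mathbf c_1=\mathbf c_2$ the $(H^1(\mathcal B))^d$ scalar product; for $m=d-1$, $M_1=M_2=(H^{1/2}(\mathcal B))^d$, $\Lambda=((H^{1/2}(\mathcal B))^d)'$ and $\mathbf c_1=\mathbf c_2$ the duality pairing. Conventions: for $\mathbf v\in(H^1_0(\Omega))^d$, $\mathbf v(\mathbf X^n)$ denotes the composition $\mathbf v\circ\mathbf X^n$ on $\mathcal B$ (in the sense of traces if $m=d-1$), where $\mathbf X^n:\mathcal B\to\Omega$; as a standing assumption, for $\mathbf X^n\in(W^{1,\infty}(\mathcal B))^d$ this is a well-defined element of $M_1$, depending linearly on $\mathbf v$. The initial data are $\mathbf u_0\in(H^1_0(\Omega))^d$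 and $\mathbf X_0\in(W^{1,\infty}(\mathcal B))^d$, and $\mathbf X^{-1}\in (H^1(\mathcal B))^d$ is a prescribed starting value (for instance, formally, $\mathbf X^{-1}=0$). *)

theory Defs
  imports "HOL-Analysis.Analysis"
begin

text \<open>
  Elements of function spaces on an open set \<open>S\<close> are represented by total functions whose values
  outside \<open>S\<close> are irrelevant; equality of elements is equality almost everywhere on \<open>S\<close>.
  A field maps \<open>real^'m\<close> to \<open>real^'d\<close>; its gradient takes values in \<open>real^'m^'d\<close>, with
  \<open>G x $ \<alpha> $ i\<close> the derivative of component \<open>\<alpha>\<close> in direction \<open>i\<close>. The inner product of that
  Euclidean space is the Frobenius product.
\<close>

subsection \<open>Domains\<close>

definition bounded_domain :: "(real^'n) set \<Rightarrow> bool" where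
  "bounded_domain S \<longleftrightarrow> open S \<and> connected S \<and> S \<noteq> {} \<and> bounded S"

text \<open>
  Near each boundary point, \<open>S\<close> is the set above the graph of a Lipschitz function. The graph
  direction is the unit vector \<open>e\<close>, and \<open>\<gamma>\<close> depends only on the component orthogonal to \<open>e\<close>.
\<close>

definition lipschitz_boundary :: "(real^'n) set \<Rightarrow> bool" where
  "lipschitz_boundary S \<longleftrightarrow>
     (\<forall>x\<in>frontier S. \<exists>r>0. \<exists>e \<gamma> L. norm e = 1 \<and> L-lipschitz_on UNIV \<gamma> \<and>
        (\<forall>y t. \<gamma> (y + t *\<^sub>R e) = (\<gamma> y :: real)) \<and>
        S \<inter> ball x r = {y \<in> ball x r. y \<bullet> e > \<gamma> y})"

subsection \<open>Test functions and weak gradients\<close>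

definition partial_deriv :: "'n \<Rightarrow> (real^'n \<Rightarrow> real) \<Rightarrow> real^'n \<Rightarrow> real" where
  "partial_deriv i \<phi> x = deriv (\<lambda>t. \<phi> (x + t *\<^sub>R axis i 1)) 0"

text \<open>All iterated partial derivatives exist and are continuous.\<close>

definition C_infinity :: "(real^'n \<Rightarrow> real) \<Rightarrow> bool" where
  "C_infinity \<phi> \<longleftrightarrow>
     (\<forall>is. continuous_on UNIV (foldr partial_deriv is \<phi>) \<and>
       (\<forall>i x. (\<lambda>t. foldr partial_deriv is \<phi> (x + t *\<^sub>R axis i 1)) differentiable (at (0::real))))"

definition test_function :: "(real^'n) set \<Rightarrow> (real^'n \<Rightarrow> real) \<Rightarrow> bool" where
  "test_function S \<phi> \<longleftrightarrow>
     C_infinity \<phi> \<and> compact (closure {x. \<phi> x \<noteq> 0}) \<and> closure {x. \<phi> x \<noteq> 0} \<subseteq> S"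

definition test_field :: "(real^'m) set \<Rightarrow> (real^'m \<Rightarrow> real^'d) \<Rightarrow> bool" where
  "test_field S \<phi> \<longleftrightarrow> (\<forall>\<alpha>. test_function S (\<lambda>x. \<phi> x $ \<alpha>))"

definition locally_integrable :: "(real^'m) set \<Rightarrow> (real^'m \<Rightarrow> 'b::euclidean_space) \<Rightarrow> bool" where
  "locally_integrable S f \<longleftrightarrow> (\<forall>K. compact K \<and> K \<subseteq> S \<longrightarrow> integrable (lebesgue_on K) f)"

definition has_weak_grad ::
  "(real^'m) set \<Rightarrow> (real^'m \<Rightarrow> real^'d) \<Rightarrow> (real^'m \<Rightarrow> real^'m^'d) \<Rightarrow> bool" where
  "has_weak_grad S f G \<longleftrightarrow> locally_integrable S f \<and> locally_integrable S G \<and>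
     (\<forall>\<phi> \<alpha> i. test_function S \<phi> \<longrightarrow>
        (LINT x|lebesgue_on S. f x $ \<alpha> * partial_deriv i \<phi> x)
          = - (LINT x|lebesgue_on S. G x $ \<alpha> $ i * \<phi> x))"

text \<open>Determined only up to null subsets of \<open>S\<close>.\<close>

definition grad :: "(real^'m) set \<Rightarrow> (real^'m \<Rightarrow> real^'d) \<Rightarrow> real^'m \<Rightarrow> real^'m^'d" where
  "grad S f = (SOME G. has_weak_grad S f G)"

definition divergence :: "(real^'d) set \<Rightarrow> (real^'d \<Rightarrow> real^'d) \<Rightarrow> real^'d \<Rightarrow> real" where
  "divergence S v x = (\<Sum>\<alpha>\<in>UNIV. grad S v x $ \<alpha> $ \<alpha>)"

definition grad_sym :: "(real^'d) set \<Rightarrow> (real^'d \<Rightarrow> real^'d) \<Rightarrow> real^'d \<Rightarrow> real^'d^'d" where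
  "grad_sym S v x = grad S v x + transpose (grad S v x)"

subsection \<open>Lebesgue and Sobolev spaces\<close>

definition L2 :: "(real^'m) set \<Rightarrow> (real^'m \<Rightarrow> 'b::euclidean_space) set" where
  "L2 S = {f \<in> borel_measurable (lebesgue_on S). integrable (lebesgue_on S) (\<lambda>x. (norm (f x))\<^sup>2)}"

definition L2_inner ::
  "(real^'m) set \<Rightarrow> (real^'m \<Rightarrow> 'b::euclidean_space) \<Rightarrow> (real^'m \<Rightarrow> 'b) \<Rightarrow> real" where
  "L2_inner S f g = (LINT x|lebesgue_on S. f x \<bullet> g x)"

definition L2_norm :: "(real^'m) set \<Rightarrow> (real^'m \<Rightarrow> 'b::euclidean_space) \<Rightarrow> real" where
  "L2_norm S f = sqrt (L2_inner S f f)"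

definition L2_zero_mean :: "(real^'m) set \<Rightarrow> (real^'m \<Rightarrow> real) set" where
  "L2_zero_mean S = {q \<in> L2 S. (LINT x|lebesgue_on S. q x) = 0}"

definition Linf :: "(real^'m) set \<Rightarrow> (real^'m \<Rightarrow> 'b::euclidean_space) set" where
  "Linf S = {f \<in> borel_measurable (lebesgue_on S). \<exists>C. AE x in lebesgue_on S. norm (f x) \<le> C}"

definition W1inf :: "(real^'m) set \<Rightarrow> (real^'m \<Rightarrow> real^'d) set" where
  "W1inf S = {f \<in> Linf S. \<exists>G \<in> Linf S. has_weak_grad S f G}"

definition H1 :: "(real^'m) set \<Rightarrow> (real^'m \<Rightarrow> real^'d) set" where
  "H1 S = {f \<in> L2 S. \<exists>G \<in> L2 S. has_weak_grad S f G}"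

definition H1_inner ::
  "(real^'m) set \<Rightarrow> (real^'m \<Rightarrow> real^'d) \<Rightarrow> (real^'m \<Rightarrow> real^'d) \<Rightarrow> real" where
  "H1_inner S f g = L2_inner S f g + L2_inner S (grad S f) (grad S g)"

definition H1_norm :: "(real^'m) set \<Rightarrow> (real^'m \<Rightarrow> real^'d) \<Rightarrow> real" where
  "H1_norm S f = sqrt (H1_inner S f f)"

definition H1_approx ::
  "(real^'m) set \<Rightarrow> (real^'m \<Rightarrow> real^'d) \<Rightarrow> (nat \<Rightarrow> real^'m \<Rightarrow> real^'d) \<Rightarrow> bool" where
  "H1_approx S v \<phi> \<longleftrightarrow>
     (\<forall>k. test_field S (\<phi> k)) \<and> (\<lambda>k. H1_norm S (\<lambda>x. v x - \<phi> k x)) \<longlonglongrightarrow> 0"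

definition H10 :: "(real^'m) set \<Rightarrow> (real^'m \<Rightarrow> real^'d) set" where
  "H10 S = {v \<in> H1 S. \<exists>\<phi>. H1_approx S v \<phi>}"

text \<open>
  Sobolev--Slobodeckij space of order \<open>1/2\<close>; the exponent is \<open>m + 2 * (1/2)\<close>.
\<close>

definition slobodeckij_quotient :: "(real^'m \<Rightarrow> real^'d) \<Rightarrow> (real^'m) \<times> (real^'m) \<Rightarrow> real" where
  "slobodeckij_quotient f = (\<lambda>(x, y). (norm (f x - f y))\<^sup>2 / norm (x - y) ^ (CARD('m) + 1))"

definition Hhalf :: "(real^'m) set \<Rightarrow> (real^'m \<Rightarrow> real^'d) set" where
  "Hhalf S = {f \<in> L2 S. integrable (lebesgue_on S \<Otimes>\<^sub>M lebesgue_on S) (slobodeckij_quotient f)}"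

definition Hhalf_norm :: "(real^'m) set \<Rightarrow> (real^'m \<Rightarrow> real^'d) \<Rightarrow> real" where
  "Hhalf_norm S f =
     sqrt (L2_inner S f f + (LINT z|(lebesgue_on S \<Otimes>\<^sub>M lebesgue_on S). slobodeckij_quotient f z))"

text \<open>
  Bounded linear functionals on a space \<open>V\<close> of fields. Boundedness makes them respect equality
  almost everywhere.
\<close>

definition dual_space ::
  "(real^'m \<Rightarrow> real^'d) set \<Rightarrow> ((real^'m \<Rightarrow> real^'d) \<Rightarrow> real) \<Rightarrow> ((real^'m \<Rightarrow> real^'d) \<Rightarrow> real) set" where
  "dual_space V nrm = {l.
     (\<forall>f\<in>V. \<forall>g\<in>V. l (\<lambda>x. f x + g x) = l f + l g) \<and>
     (\<forall>f\<in>V. \<forall>c. l (\<lambda>x. c *\<^sub>R f x) = c * l f) \<and>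
     (\<exists>C. \<forall>f\<in>V. \<bar>l f\<bar> \<le> C * nrm f)}"

subsection \<open>Fluid forms\<close>

definition a_form ::
  "(real^'d) set \<Rightarrow> real \<Rightarrow> (real^'d \<Rightarrow> real^'d) \<Rightarrow> (real^'d \<Rightarrow> real^'d) \<Rightarrow> real" where
  "a_form \<Omega> \<nu> u v = \<nu> * L2_inner \<Omega> (grad_sym \<Omega> u) (grad_sym \<Omega> v)"

definition convect ::
  "(real^'d) set \<Rightarrow> (real^'d \<Rightarrow> real^'d) \<Rightarrow> (real^'d \<Rightarrow> real^'d) \<Rightarrow> real^'d \<Rightarrow> real^'d" where
  "convect \<Omega> u v x = grad \<Omega> v x *v u x"

definition b_form ::
  "(real^'d) set \<Rightarrow> real \<Rightarrow> (real^'d \<Rightarrow> real^'d) \<Rightarrow> (real^'d \<Rightarrow> real^'d) \<Rightarrow> (real^'d \<Rightarrow> real^'d) \<Rightarrow> real" where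
  "b_form \<Omega> \<rho> u v w =
     \<rho> / 2 * (L2_inner \<Omega> (convect \<Omega> u v) w - L2_inner \<Omega> (convect \<Omega> u w) v)"

subsection \<open>Elasticity\<close>

definition piola_kirchhoff :: "(real^'m^'d \<Rightarrow> real) \<Rightarrow> real^'m^'d \<Rightarrow> real^'m^'d" where
  "piola_kirchhoff W F = (\<chi> \<alpha> i. deriv (\<lambda>t. W (F + t *\<^sub>R axis \<alpha> (axis i 1))) 0)"

definition C1_density :: "(real^'m^'d \<Rightarrow> real) \<Rightarrow> bool" where
  "C1_density W \<longleftrightarrow> (\<forall>F. W differentiable (at F)) \<and> continuous_on UNIV (piola_kirchhoff W)"

definition elastic_energy ::
  "(real^'m) set \<Rightarrow> (real^'m^'d \<Rightarrow> real) \<Rightarrow> (real^'m \<Rightarrow> real^'d) \<Rightarrow> real" where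
  "elastic_energy B W X = (LINT s|lebesgue_on B. W (grad B X s))"

subsection \<open>Multipliers and coupling\<close>

datatype ('d::finite, 'm::finite) multiplier =
    Functional "(real^'m \<Rightarrow> real^'d) \<Rightarrow> real"
  | Field "real^'m \<Rightarrow> real^'d"

primrec coupling :: "(real^'m) set \<Rightarrow> ('d::finite, 'm::finite) multiplier \<Rightarrow> (real^'m \<Rightarrow> real^'d) \<Rightarrow> real" where
  "coupling B (Functional l) Z = l Z"
| "coupling B (Field \<mu>) Z = H1_inner B \<mu> Z"

text \<open>
  The three admissible choices: for a thick structure, duality on \<open>H1\<close> or the scalar product of
  \<open>H1\<close>; for a thin structure, duality on \<open>Hhalf\<close>.
\<close>

definition coupling_setting ::
  "(real^'m) set \<Rightarrow> ('d::finite, 'm::finite) multiplier set \<Rightarrow>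
   (real^'m \<Rightarrow> real^'d) set \<Rightarrow> (real^'m \<Rightarrow> real^'d) set \<Rightarrow>
   (('d, 'm) multiplier \<Rightarrow> (real^'m \<Rightarrow> real^'d) \<Rightarrow> real) \<Rightarrow>
   (('d, 'm) multiplier \<Rightarrow> (real^'m \<Rightarrow> real^'d) \<Rightarrow> real) \<Rightarrow> bool" where
  "coupling_setting B \<Lambda> M1 M2 c1 c2 \<longleftrightarrow> c1 = coupling B \<and> c2 = coupling B \<and>
     (CARD('m) = CARD('d) \<and> M1 = H1 B \<and> M2 = H1 B \<and>
        (\<Lambda> = Functional ` dual_space (H1 B) (H1_norm B) \<or> \<Lambda> = Field ` H1 B)
    \<or> CARD('m) + 1 = CARD('d) \<and> M1 = Hhalf B \<and> M2 = Hhalf B \<and>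
        \<Lambda> = Functional ` dual_space (Hhalf B) (Hhalf_norm B))"

text \<open>
  The trace of \<open>v\<close> along \<open>X\<close> is the continuous extension of \<open>\<phi> \<mapsto> \<phi> \<circ> X\<close> from test fields:
  it is the common limit over all sequences of test fields that converge to \<open>v\<close>.
\<close>

definition is_trace_along ::
  "(real^'d) set \<Rightarrow> (real^'m) set \<Rightarrow> (real^'m \<Rightarrow> real^'d) \<Rightarrow> (real^'d \<Rightarrow> real^'d) \<Rightarrow>
   (real^'m \<Rightarrow> real^'d) \<Rightarrow> bool" where
  "is_trace_along \<Omega> B X v Z \<longleftrightarrow> Z \<in> L2 B \<and>
     (\<forall>\<phi>. H1_approx \<Omega> v \<phi> \<longrightarrow> (\<lambda>k. L2_norm B (\<lambda>s. \<phi> k (X s) - Z s)) \<longlonglongrightarrow> 0)"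

definition eval_along ::
  "(real^'d) set \<Rightarrow> (real^'m) set \<Rightarrow> (real^'m \<Rightarrow> real^'d) \<Rightarrow> (real^'d \<Rightarrow> real^'d) \<Rightarrow> real^'m \<Rightarrow> real^'d" where
  "eval_along \<Omega> B X v =
     (if CARD('m) = CARD('d) then v \<circ> X else (SOME Z. is_trace_along \<Omega> B X v Z))"

text \<open>
  Well-definedness is a condition on the individual deformation \<open>X\<close>: for a degenerate Lipschitz
  map, e.g. a constant one, composition does not respect equality almost everywhere.
\<close>

definition eval_well_defined ::
  "(real^'d) set \<Rightarrow> (real^'m) set \<Rightarrow> (real^'m \<Rightarrow> real^'d) set \<Rightarrow> (real^'m \<Rightarrow> real^'d) \<Rightarrow> bool" where
  "eval_well_defined \<Omega> B M X \<longleftrightarrow>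
     (AE s in lebesgue_on B. X s \<in> \<Omega>) \<and>
     (\<forall>v\<in>H10 \<Omega>. eval_along \<Omega> B X v \<in> M) \<and>
     (CARD('m) \<noteq> CARD('d) \<longrightarrow> (\<forall>v\<in>H10 \<Omega>. \<exists>Z. is_trace_along \<Omega> B X v Z)) \<and>
     (\<forall>v\<in>H10 \<Omega>. \<forall>w\<in>H10 \<Omega>. (AE x in lebesgue_on \<Omega>. v x = w x) \<longrightarrow>
        (AE s in lebesgue_on B. eval_along \<Omega> B X v s = eval_along \<Omega> B X w s)) \<and>
     (\<forall>v\<in>H10 \<Omega>. \<forall>w\<in>H10 \<Omega>. \<forall>c d. AE s in lebesgue_on B.
        eval_along \<Omega> B X (\<lambda>x. c *\<^sub>R v x + d *\<^sub>R w x) s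
          = c *\<^sub>R eval_along \<Omega> B X v s + d *\<^sub>R eval_along \<Omega> B X w s)"

end

theory Submission
  imports Defs
begin

text \<open>
  Testing the momentum equation with \<open>u\<^sup>n\<^sup>+\<^sup>1\<close> and the structure equation with
  \<open>Y = (X\<^sup>n\<^sup>+\<^sup>1 - X\<^sup>n) / \<Delta>t\<close> makes the convection, pressure and multiplier terms cancel. The difference
  quotients are bounded below through \<open>2 (a - b) \<bullet> a \<ge> \<bar>a\<bar>\<^sup>2 - \<bar>b\<bar>\<^sup>2\<close>, and the elastic term through the
  tangent inequality for the convex density \<open>W\<close> at \<open>F\<^sup>n\<^sup>+\<^sup>1\<close>. The latter needs the gradient of \<open>Y\<close> to be
  the difference quotient of the gradients almost everywhere, that is, uniqueness of weak
  gradients. This is reduced to integrals over boxes, whose indicators are limits of products of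
  dilated copies of the flat function \<open>exp (- 1 / t)\<close>.
\<close>

subsection \<open>Smooth functions and their products\<close>

text \<open>Finite orders are tracked so that closure properties can be proved by induction on the
  order, with the functions generalised: the derivative of a product is a sum of new
  products.\<close>

primrec times_differentiable :: "nat \<Rightarrow> (real \<Rightarrow> real) \<Rightarrow> bool" where
  "times_differentiable 0 g \<longleftrightarrow> True"
| "times_differentiable (Suc k) g \<longleftrightarrow> (\<forall>x. g differentiable (at x)) \<and> times_differentiable k (deriv g)"

definition smooth :: "(real \<Rightarrow> real) \<Rightarrow> bool" where
  "smooth g \<longleftrightarrow> (\<forall>k. times_differentiable k g)"

text \<open>Links \<open>differentiable\<close>, in which the smoothness notions are phrased, with
  \<open>field_differentiable\<close>, in which \<open>deriv_add\<close> and
  \<open>deriv_mult\<close> are stated.\<close>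

lemma real_differentiable_iff_field_differentiable:
  "(g :: real \<Rightarrow> real) differentiable (at x within S) \<longleftrightarrow> g field_differentiable (at x within S)"
  by (simp add: field_differentiable_def real_differentiable_def)

lemma smooth_imp_differentiable: "smooth g \<Longrightarrow> g differentiable (at x)"
  unfolding smooth_def by (metis times_differentiable.simps(2))

lemma smooth_deriv: "smooth g \<Longrightarrow> smooth (deriv g)"
  unfolding smooth_def by (metis times_differentiable.simps(2))

lemma times_differentiable_Suc_D:
  "times_differentiable (Suc k) g \<Longrightarrow> times_differentiable k g"
  by (induction k arbitrary: g) auto

lemma times_differentiable_add:
  "times_differentiable k g \<Longrightarrow> times_differentiable k h \<Longrightarrow> times_differentiable k (\<lambda>x. g x + h x)"
proof (induction k arbitrary: g h)
  case (Suc k)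
  then have "deriv (\<lambda>x. g x + h x) = (\<lambda>x. deriv g x + deriv h x)"
    by (intro ext deriv_add) (simp_all flip: real_differentiable_iff_field_differentiable)
  with Suc show ?case by auto
qed simp

text \<open>By the Leibniz rule the derivative pairs one factor with the derivative of the other, so
  the undifferentiated factor must first be lowered to order \<open>k\<close>.\<close>

lemma times_differentiable_mult:
  "times_differentiable k g \<Longrightarrow> times_differentiable k h \<Longrightarrow> times_differentiable k (\<lambda>x. g x * h x)"
proof (induction k arbitrary: g h)
  case (Suc k)
  have "times_differentiable k g" "times_differentiable k h"
    using Suc.prems times_differentiable_Suc_D by blast+
  then have "times_differentiable k (\<lambda>x. g x * deriv h x + deriv g x * h x)"
    using Suc by (intro times_differentiable_add Suc.IH) auto
  moreover have "deriv (\<lambda>x. g x * h x) = (\<lambda>x. g x * deriv h x + deriv g x * h x)"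
    using Suc.prems by (intro ext deriv_mult) (simp_all flip: real_differentiable_iff_field_differentiable)
  ultimately show ?case using Suc.prems by (auto intro: differentiable_mult)
qed simp

text \<open>The outer factor \<open>r\<close> carries the induction: the chain rule turns
  \<open>r\<close> into \<open>r * m\<close>, so the derivative has the same shape with
  \<open>deriv g\<close> for \<open>g\<close>.\<close>

lemma times_differentiable_affine:
  "times_differentiable k g \<Longrightarrow> times_differentiable k (\<lambda>x. r * g (m * x + c))"
proof (induction k arbitrary: g r)
  case (Suc k)
  have D: "((\<lambda>x. r * g (m * x + c)) has_real_derivative r * m * deriv g (m * x + c)) (at x)" for x
  proof -
    have "(g has_real_derivative deriv g (m * x + c)) (at (m * x + c))"
      using Suc.prems by (simp add: DERIV_deriv_iff_real_differentiable)
    then have "((\<lambda>x. g (m * x + c)) has_real_derivative deriv g (m * x + c) * m) (at x)"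
      by (rule DERIV_chain2) (auto intro!: derivative_eq_intros)
    from DERIV_cmult[OF this, of r] show ?thesis by (simp add: mult_ac)
  qed
  then have "deriv (\<lambda>x. r * g (m * x + c)) = (\<lambda>x. r * m * deriv g (m * x + c))"
    by (intro ext DERIV_imp_deriv)
  with Suc D show ?case
    by (auto simp: real_differentiable_def simp del: mult.assoc)
qed simp

lemma smooth_mult: "smooth g \<Longrightarrow> smooth h \<Longrightarrow> smooth (\<lambda>x. g x * h x)"
  by (simp add: smooth_def times_differentiable_mult)

lemma smooth_affine: "smooth g \<Longrightarrow> smooth (\<lambda>x. g (m * x + c))"
  using times_differentiable_affine[where r = 1] by (simp add: smooth_def)

text \<open>The polynomial factor makes this family closed under differentiation.\<close>

definition flat :: "real poly \<Rightarrow> real \<Rightarrow> real" where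
  "flat p t = (if t > 0 then poly p (1 / t) * exp (- (1 / t)) else 0)"

lemma tendsto_poly_div_exp_0: "((\<lambda>y::real. poly p y / exp y) \<longlongrightarrow> 0) at_top"
proof -
  have "((\<lambda>y::real. \<Sum>i\<le>degree p. coeff p i * (y ^ i / exp y)) \<longlongrightarrow> (\<Sum>i\<le>degree p. coeff p i * 0)) at_top"
    by (intro tendsto_intros tendsto_power_div_exp_0)
  then show ?thesis by (simp add: poly_altdef sum_divide_distrib)
qed

text \<open>With y = 1 / t, the derivative of p(y) exp(-y) in t is y^2 (p(y) - p'(y)) exp(-y); the
  two \<open>pCons 0\<close> are the factor y^2. At t = 0 the exponential beats every polynomial in
  y.\<close>

lemma has_real_derivative_flat:
  "(flat p has_real_derivative flat (pCons 0 (pCons 0 (p - pderiv p))) t) (at t)"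
proof -
  consider "t > 0" | "t < 0" | "t = 0" by linarith
  then show ?thesis
  proof cases
    case 1
    have "((\<lambda>t. poly p (1 / t) * exp (- (1 / t))) has_real_derivative
        flat (pCons 0 (pCons 0 (p - pderiv p))) t) (at t)"
    proof -
      have "((\<lambda>t. poly p (1 / t)) has_real_derivative poly (pderiv p) (1 / t) * (- (1 / t\<^sup>2))) (at t)"
        using 1 by (intro DERIV_chain2[OF poly_DERIV])
          (auto intro!: derivative_eq_intros simp: power2_eq_square)
      moreover have "((\<lambda>t. exp (- (1 / t))) has_real_derivative exp (- (1 / t)) * (1 / t\<^sup>2)) (at t)"
        using 1 by (auto intro!: derivative_eq_intros simp: power2_eq_square)
      ultimately show ?thesis
        using DERIV_mult 1 by (fastforce simp: flat_def algebra_simps power2_eq_square)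
    qed
    then show ?thesis
      by (rule has_field_derivative_transform_within_open[where S = "{0<..}"])
        (use 1 in \<open>auto simp: flat_def\<close>)
  next
    case 2
    have "((\<lambda>t. 0) has_real_derivative 0) (at t)" by simp
    then have "(flat p has_real_derivative 0) (at t)"
      by (rule has_field_derivative_transform_within_open[where S = "{..<0}"])
        (use 2 in \<open>auto simp: flat_def\<close>)
    then show ?thesis using 2 by (simp add: flat_def)
  next
    case 3
    have "((\<lambda>h. flat p h / h) \<longlongrightarrow> 0) (at_right 0)"
    proof -
      \<comment> \<open>The additional \<open>pCons 0\<close> absorbs the division by
        \<open>h\<close>: with y = 1 / h, the difference quotient at 0 is y p(y) / exp y.\<close>
      have "((\<lambda>h. poly (pCons 0 p) (inverse h) / exp (inverse h)) \<longlongrightarrow> 0) (at_right (0::real))"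
        using filterlim_compose[OF tendsto_poly_div_exp_0 filterlim_inverse_at_top_right] .
      moreover have "\<forall>\<^sub>F h in at_right 0. poly (pCons 0 p) (inverse h) / exp (inverse h) = flat p h / h"
        by (intro eventually_at_rightI[of 0 1]) (auto simp: flat_def exp_minus field_simps)
      ultimately show ?thesis by (rule Lim_transform_eventually)
    qed
    moreover have "((\<lambda>h. flat p h / h) \<longlongrightarrow> 0) (at_left 0)"
      by (rule tendsto_eventually) (auto simp: flat_def intro!: eventually_at_leftI[of "-1"])
    ultimately have "((\<lambda>h. flat p h / h) \<longlongrightarrow> 0) (at 0)"
      by (simp add: filterlim_at_split)
    then show ?thesis using 3 by (simp add: has_field_derivative_iff flat_def)
  qed
qed

lemma smooth_flat: "smooth (flat p)"
proof -
  have "times_differentiable k (flat p)" for k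
  proof (induction k arbitrary: p)
    case (Suc k)
    have "deriv (flat p) = flat (pCons 0 (pCons 0 (p - pderiv p)))"
      by (intro ext DERIV_imp_deriv has_real_derivative_flat)
    with Suc show ?case
      using has_real_derivative_flat by (auto simp: real_differentiable_def)
  qed simp
  then show ?thesis by (simp add: smooth_def)
qed

section \<open>Products of smooth functions of one coordinate each\<close>

lemma prod_nth_update:
  fixes g :: "'n::finite \<Rightarrow> real \<Rightarrow> real"
  shows "(\<Prod>j\<in>UNIV. g j ((x + t *\<^sub>R axis i 1) $ j)) =
    g i (x $ i + t) * (\<Prod>j\<in>UNIV - {i}. g j (x $ j))"
proof -
  have "(\<Prod>j\<in>UNIV. g j ((x + t *\<^sub>R axis i 1) $ j)) =
    g i ((x + t *\<^sub>R axis i 1) $ i) * (\<Prod>j\<in>UNIV - {i}. g j ((x + t *\<^sub>R axis i 1) $ j))"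
    by (rule prod.remove) auto
  also have "(\<Prod>j\<in>UNIV - {i}. g j ((x + t *\<^sub>R axis i 1) $ j)) = (\<Prod>j\<in>UNIV - {i}. g j (x $ j))"
    by (intro prod.cong) (auto simp: axis_def)
  finally show ?thesis by (simp add: axis_def)
qed

lemma has_partial_derivative_prod:
  fixes g :: "'n::finite \<Rightarrow> real \<Rightarrow> real"
  assumes "\<And>j. smooth (g j)"
  shows "((\<lambda>t. \<Prod>j\<in>UNIV. g j ((x + t *\<^sub>R axis i 1) $ j)) has_real_derivative
    deriv (g i) (x $ i + t) * (\<Prod>j\<in>UNIV - {i}. g j (x $ j))) (at t)"
proof -
  have "(g i has_real_derivative deriv (g i) (x $ i + t)) (at (x $ i + t))"
    using assms smooth_imp_differentiable by (simp add: DERIV_deriv_iff_real_differentiable)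
  then have "((\<lambda>t. g i (x $ i + t)) has_real_derivative deriv (g i) (x $ i + t) * 1) (at t)"
    by (rule DERIV_chain2) (auto intro!: derivative_eq_intros)
  then show ?thesis
    unfolding prod_nth_update by (auto intro!: derivative_eq_intros)
qed

text \<open>Only the factor of coordinate \<open>i\<close> depends on the direction of
  differentiation. The result is a product of the same kind, so partial derivatives can be
  iterated.\<close>

lemma partial_deriv_prod:
  fixes g :: "'n::finite \<Rightarrow> real \<Rightarrow> real"
  assumes "\<And>j. smooth (g j)"
  shows "partial_deriv i (\<lambda>x. \<Prod>j\<in>UNIV. g j (x $ j)) =
    (\<lambda>x. \<Prod>j\<in>UNIV. (g(i := deriv (g i))) j (x $ j))"
proof
  fix x :: "real^'n"
  have "partial_deriv i (\<lambda>x. \<Prod>j\<in>UNIV. g j (x $ j)) x =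
      deriv (g i) (x $ i) * (\<Prod>j\<in>UNIV - {i}. g j (x $ j))"
    using DERIV_imp_deriv[OF has_partial_derivative_prod[of g x i 0, OF assms]]
    by (simp add: partial_deriv_def)
  also have "\<dots> = (\<Prod>j\<in>UNIV. (g(i := deriv (g i))) j (x $ j))"
    by (subst prod.remove[of _ i]) (auto intro!: prod.cong)
  finally show "partial_deriv i (\<lambda>x. \<Prod>j\<in>UNIV. g j (x $ j)) x =
    (\<Prod>j\<in>UNIV. (g(i := deriv (g i))) j (x $ j))" .
qed

lemma C_infinity_prod:
  fixes g :: "'n::finite \<Rightarrow> real \<Rightarrow> real"
  assumes "\<And>j. smooth (g j)"
  shows "C_infinity (\<lambda>x. \<Prod>j\<in>UNIV. g j (x $ j))"
proof -
  \<comment> \<open>Every iterated partial derivative is again a product of smooth factors, so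
    continuity and directional differentiability need checking for such products only.\<close>
  have iter: "\<exists>h. (\<forall>j. smooth (h j)) \<and>
    foldr partial_deriv is (\<lambda>x. \<Prod>j\<in>UNIV. g j (x $ j)) = (\<lambda>x. \<Prod>j\<in>UNIV. h j (x $ j))" for "is"
  proof (induction "is")
    case Nil
    show ?case using assms by auto
  next
    case (Cons i "is")
    then obtain h where h: "\<And>j. smooth (h j)"
      "foldr partial_deriv is (\<lambda>x. \<Prod>j\<in>UNIV. g j (x $ j)) = (\<lambda>x. \<Prod>j\<in>UNIV. h j (x $ j))"
      by blast
    \<comment> \<open>The update is kept folded while \<open>partial_deriv_prod\<close> settles the
      equation; the second \<open>simp\<close> unfolds it for the smoothness of the new
      family.\<close>
    show ?case
      by (rule exI[of _ "h(i := deriv (h i))"])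
        (simp add: h partial_deriv_prod smooth_deriv del: fun_upd_apply, simp add: h smooth_deriv)
  qed
  have regular: "continuous_on UNIV (\<lambda>x. \<Prod>j\<in>UNIV. h j (x $ j)) \<and>
      (\<forall>i x. (\<lambda>t. \<Prod>j\<in>UNIV. h j ((x + t *\<^sub>R axis i 1) $ j)) differentiable (at (0::real)))"
    if h: "\<And>j. smooth (h j)" for h :: "'n \<Rightarrow> real \<Rightarrow> real"
  proof
    have "continuous_on UNIV (h j)" for j
      by (intro continuous_at_imp_continuous_on ballI differentiable_imp_continuous_within
          smooth_imp_differentiable h)
    then show "continuous_on UNIV (\<lambda>x. \<Prod>j\<in>UNIV. h j (x $ j))"
      by (intro continuous_on_prod continuous_on_compose2[of UNIV "h _" UNIV "\<lambda>x. x $ _"]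
          continuous_on_component continuous_on_id) simp_all
    show "\<forall>i x. (\<lambda>t. \<Prod>j\<in>UNIV. h j ((x + t *\<^sub>R axis i 1) $ j)) differentiable (at (0::real))"
      unfolding real_differentiable_def
      by (intro allI exI) (rule has_partial_derivative_prod[OF h])
  qed
  show ?thesis
    unfolding C_infinity_def
  proof
    fix "is"
    from iter[of "is"] obtain h where "\<And>j. smooth (h j)"
      "foldr partial_deriv is (\<lambda>x. \<Prod>j\<in>UNIV. g j (x $ j)) = (\<lambda>x. \<Prod>j\<in>UNIV. h j (x $ j))"
      by blast
    then show "continuous_on UNIV (foldr partial_deriv is (\<lambda>x. \<Prod>j\<in>UNIV. g j (x $ j))) \<and>
      (\<forall>i x. (\<lambda>t. foldr partial_deriv is (\<lambda>x. \<Prod>j\<in>UNIV. g j (x $ j)) (x + t *\<^sub>R axis i 1))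
        differentiable (at (0::real)))"
      using regular[of h] by simp
  qed
qed

subsection \<open>Box bumps and the fundamental lemma of the calculus of variations\<close>

text \<open>A smooth approximation of the indicator of the open box from below: exp(-1 / ((k+1) s))
  tends to 1 for s > 0, while the flat factor is 0 for s \<le> 0. \<open>Suc k\<close> avoids the
  dilation by 0.\<close>

definition box_bump :: "real^'n \<Rightarrow> real^'n \<Rightarrow> nat \<Rightarrow> real^'n \<Rightarrow> real" where
  "box_bump a b k x =
    (\<Prod>j\<in>UNIV. flat 1 (Suc k * (x $ j - a $ j)) * flat 1 (Suc k * (b $ j - x $ j)))"

lemma flat_1_bounds: "0 \<le> flat 1 t" "flat 1 t \<le> 1"
  by (auto simp: flat_def)

lemma flat_1_eq_0: "t \<le> 0 \<Longrightarrow> flat 1 t = 0"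
  by (simp add: flat_def)

lemma flat_1_dilation_tendsto:
  fixes t :: real
  shows "(\<lambda>k. flat 1 (Suc k * t)) \<longlonglongrightarrow> (if t > 0 then 1 else 0)"
proof (cases "t > 0")
  case True
  have "(\<lambda>k. exp (- (inverse (real (Suc k)) * (1 / t)))) \<longlonglongrightarrow> exp (- (0 * (1 / t)))"
    by (intro tendsto_intros LIMSEQ_inverse_real_of_nat)
  moreover have "exp (- (inverse (real (Suc k)) * (1 / t))) = flat 1 (Suc k * t)" for k
    using True by (simp add: flat_def inverse_eq_divide zero_less_mult_iff del: of_nat_Suc)
  ultimately show ?thesis using True by (simp del: of_nat_Suc)
next
  case False
  then have "real (Suc k) * t \<le> 0" for k
    by (simp add: mult_nonneg_nonpos)
  then show ?thesis using False flat_1_eq_0 by simp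
qed

lemma box_bump_bounds: "0 \<le> box_bump a b k x" "box_bump a b k x \<le> 1"
  unfolding box_bump_def
  by (auto intro!: prod_nonneg prod_le_1 mult_nonneg_nonneg mult_le_one flat_1_bounds)

lemma box_bump_eq_0: "x \<notin> box a b \<Longrightarrow> box_bump a b k x = 0"
proof -
  assume "x \<notin> box a b"
  then obtain j where "\<not> (a $ j < x $ j \<and> x $ j < b $ j)"
    by (auto simp: mem_box_cart)
  then have "real (Suc k) * (x $ j - a $ j) \<le> 0 \<or> real (Suc k) * (b $ j - x $ j) \<le> 0"
    by (auto intro!: mult_nonneg_nonpos)
  then have "flat 1 (Suc k * (x $ j - a $ j)) * flat 1 (Suc k * (b $ j - x $ j)) = 0"
    using flat_1_eq_0 by auto
  then show ?thesis
    unfolding box_bump_def by (intro prod_zero) auto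
qed

text \<open>The limit is 0 on the faces as well, since there some factor is \<open>flat 1 0\<close>
  for every \<open>k\<close>; hence the open box.\<close>

lemma box_bump_tendsto_indicator: "(\<lambda>k. box_bump a b k x) \<longlonglongrightarrow> indicator (box a b) x"
proof -
  let ?L = "\<lambda>j. (if x $ j - a $ j > 0 then 1 else 0) * (if b $ j - x $ j > 0 then 1 else 0) :: real"
  have "(\<lambda>k. box_bump a b k x) \<longlonglongrightarrow> (\<Prod>j\<in>UNIV. ?L j)"
    unfolding box_bump_def by (intro tendsto_prod tendsto_mult flat_1_dilation_tendsto)
  moreover have "(\<Prod>j\<in>UNIV. ?L j) = indicator (box a b) x"
  proof (cases "x \<in> box a b")
    case False
    then have "\<exists>j\<in>UNIV. ?L j = 0" by (force simp: mem_box_cart)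
    then have "(\<Prod>j\<in>UNIV. ?L j) = 0" by (intro prod_zero) simp_all
    with False show ?thesis by simp
  qed (auto simp: mem_box_cart intro!: prod.neutral)
  ultimately show ?thesis by simp
qed

lemma C_infinity_box_bump: "C_infinity (box_bump a b k)"
proof -
  have "smooth (\<lambda>t. flat 1 (m * t + c) * flat 1 (m' * t + c'))" for m c m' c'
    by (intro smooth_mult smooth_affine smooth_flat)
  \<comment> \<open>Each flat factor is an affine dilation, of slope \<open>Suc k\<close> and
    \<open>- Suc k\<close>, whose argument vanishes at \<open>a $ j\<close> and at
    \<open>b $ j\<close> respectively.\<close>
  from this[of "Suc k" "- (Suc k * a $ j)" "- Suc k" "Suc k * b $ j" for j]
  have "smooth (\<lambda>t. flat 1 (Suc k * (t - a $ j)) * flat 1 (Suc k * (b $ j - t)))" for j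
    by (simp add: algebra_simps)
  from C_infinity_prod[OF this] show ?thesis
    unfolding box_bump_def .
qed

text \<open>Supports are closures, which is why the closed box is required to lie in
  \<open>S\<close>.\<close>

lemma test_function_box_bump:
  assumes "cbox a b \<subseteq> S"
  shows "test_function S (box_bump a b k)"
proof -
  have "{x. box_bump a b k x \<noteq> 0} \<subseteq> cbox a b"
    using box_bump_eq_0 box_subset_cbox by blast
  then have sub: "closure {x. box_bump a b k x \<noteq> 0} \<subseteq> cbox a b"
    by (intro closure_minimal) auto
  then have "bounded (closure {x. box_bump a b k x \<noteq> 0})"
    using bounded_cbox bounded_subset by blast
  then show ?thesis
    using sub assms C_infinity_box_bump
    by (auto simp: test_function_def compact_eq_bounded_closed)
qed

section \<open>Auxiliary facts on smoothness, measurability and local integrability\<close>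

lemma C_infinity_continuous: "C_infinity \<phi> \<Longrightarrow> continuous_on UNIV \<phi>"
  unfolding C_infinity_def by (drule spec[of _ "[]"]) simp

lemma C_infinity_partial_deriv:
  assumes "C_infinity \<phi>"
  shows "C_infinity (partial_deriv i \<phi>)"
  unfolding C_infinity_def
proof
  fix "is"
  show "continuous_on UNIV (foldr partial_deriv is (partial_deriv i \<phi>)) \<and>
    (\<forall>j x. (\<lambda>t. foldr partial_deriv is (partial_deriv i \<phi>) (x + t *\<^sub>R axis j 1))
      differentiable (at (0::real)))"
    \<comment> \<open>\<open>foldr\<close> applies the last list entry first, so the inner
      derivative is appended at the end.\<close>
    using spec[OF assms[unfolded C_infinity_def], of "is @ [i]"] by simp
qed

lemma measurable_lebesgue_continuous:
  fixes f :: "'a::euclidean_space \<Rightarrow> 'b::euclidean_space"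
  shows "continuous_on UNIV f \<Longrightarrow> f \<in> borel_measurable lebesgue"
  by (intro measurable_completion) (simp add: borel_measurable_continuous_onI)

lemma locally_integrable_cbox:
  assumes "locally_integrable S h" "cbox a b \<subseteq> S"
  shows "integrable lebesgue (\<lambda>x. indicator (cbox a b) x *\<^sub>R h x)"
proof -
  have "integrable (lebesgue_on (cbox a b)) h"
    using assms by (auto simp: locally_integrable_def)
  then show ?thesis
    by (subst (asm) integrable_restrict_space) auto
qed

text \<open>The box bumps are admissible test functions and converge to the indicator of the box.
  Dominated convergence applies with the majorant \<bar>h\<bar> on the closed box, integrable
  because that box is a compact subset of \<open>S\<close>.\<close>

lemma integral_box_eq_0:
  fixes h :: "real^'n \<Rightarrow> real"
  assumes h: "locally_integrable S h" and S: "open S"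
    and test: "\<And>\<phi>. test_function S \<phi> \<Longrightarrow> (LINT x|lebesgue_on S. h x * \<phi> x) = 0"
    and sub: "cbox a b \<subseteq> S"
  shows "(LINT x:box a b|lebesgue. h x) = 0"
proof -
  have h_int: "integrable lebesgue (\<lambda>x. indicator (cbox a b) x * h x)"
    using locally_integrable_cbox[OF h sub] by simp
  have [measurable]: "box_bump a b k \<in> borel_measurable lebesgue" for k
    by (intro measurable_lebesgue_continuous C_infinity_continuous C_infinity_box_bump)
  have "(\<lambda>k. LINT x|lebesgue. (indicator (cbox a b) x * h x) * box_bump a b k x) \<longlonglongrightarrow>
      (LINT x|lebesgue. (indicator (cbox a b) x * h x) * indicator (box a b) x)"
  proof (rule integral_dominated_convergence[where w = "\<lambda>x. \<bar>indicator (cbox a b) x * h x\<bar>"])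
    show "AE x in lebesgue. (\<lambda>k. (indicator (cbox a b) x * h x) * box_bump a b k x) \<longlonglongrightarrow>
        (indicator (cbox a b) x * h x) * indicator (box a b) x"
      by (intro AE_I2 tendsto_mult tendsto_const box_bump_tendsto_indicator)
    show "AE x in lebesgue. norm ((indicator (cbox a b) x * h x) * box_bump a b k x) \<le>
        \<bar>indicator (cbox a b) x * h x\<bar>" for k
      using box_bump_bounds[of a b k] by (auto simp: abs_mult intro!: mult_left_le AE_I2)
    show "(\<lambda>x. (indicator (cbox a b) x * h x) * indicator (box a b) x) \<in> borel_measurable lebesgue"
      by (intro borel_measurable_times borel_measurable_integrable[OF h_int] borel_measurable_indicator) simp
    show "(\<lambda>x. (indicator (cbox a b) x * h x) * box_bump a b k x) \<in> borel_measurable lebesgue" for k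
      by (intro borel_measurable_times borel_measurable_integrable[OF h_int]) simp
    show "integrable lebesgue (\<lambda>x. \<bar>indicator (cbox a b) x * h x\<bar>)"
      using h_int by (rule integrable_abs)
  qed
  moreover have "(LINT x|lebesgue. (indicator (cbox a b) x * h x) * box_bump a b k x) = 0" for k
  proof -
    \<comment> \<open>The bump vanishes off the open box, so the cutoff to the closed box may be
      exchanged for the cutoff to \<open>S\<close>.\<close>
    have "(indicator (cbox a b) x * h x) * box_bump a b k x =
        indicator S x *\<^sub>R (h x * box_bump a b k x)" for x
      using sub box_subset_cbox[of a b] box_bump_eq_0[of x a b k] by (auto simp: indicator_def)
    then have "(LINT x|lebesgue. (indicator (cbox a b) x * h x) * box_bump a b k x) =
        (LINT x|lebesgue_on S. h x * box_bump a b k x)"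
      using S by (simp only:) (simp add: integral_restrict_space)
    then show ?thesis
      using test[OF test_function_box_bump[OF sub]] by (simp only:)
  qed
  moreover have "(indicator (cbox a b) x * h x) * indicator (box a b) x = indicator (box a b) x *\<^sub>R h x" for x
    using box_subset_cbox[of a b] by (auto simp: indicator_def)
  ultimately show ?thesis
    by (simp add: set_lebesgue_integral_def LIMSEQ_const_iff)
qed

text \<open>Open boxes are closed under intersection and generate the Borel sets. The sets over
  which \<open>f\<close> integrates to 0 are closed under complements and countable disjoint unions,
  so they include all Borel sets, and the density \<open>f\<close> is null.\<close>

lemma AE_eq_0_if_box_integrals_eq_0:
  fixes f :: "'a::euclidean_space \<Rightarrow> real"
  assumes f: "integrable lborel f" and box: "\<And>a b. (LINT x:box a b|lborel. f x) = 0"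
  shows "AE x in lborel. f x = 0"
proof (rule sigma_finite_measure.density_zero[OF sigma_finite_lborel f])
  have int: "set_integrable lborel A f" if "A \<in> sets borel" for A
    using that f integrable_mult_indicator[of A lborel f] by (simp add: set_integrable_def)
  \<comment> \<open>The integral over the whole space, needed for complements, is the limit over
    growing centred boxes.\<close>
  have total: "(LINT x|lborel. f x) = 0"
  proof -
    let ?Q = "\<lambda>n. box (- (real n *\<^sub>R One)) (real n *\<^sub>R One) :: 'a set"
    have "(\<lambda>n. LINT x:?Q n|lborel. f x) \<longlonglongrightarrow> (LINT x:(\<Union>n. ?Q n)|lborel. f x)"
    proof (rule set_integral_cont_up)
      show "incseq ?Q"
        by (intro incseq_SucI subset_box_imp) (auto simp: algebra_simps)
    qed (use int in auto)
    then show ?thesis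
      using box by (simp add: UN_box_eq_UNIV set_lebesgue_integral_def LIMSEQ_const_iff)
  qed
  fix A :: "'a set" assume "A \<in> sets lborel"
  then have A: "A \<in> sigma_sets UNIV (range (\<lambda>(a, b). box a b))"
    by (simp add: borel_eq_box)
  have "Int_stable (range (\<lambda>(a, b). box a b :: 'a set))"
    by (auto simp: Int_stable_def box_Int_box)
  moreover have "range (\<lambda>(a, b). box a b :: 'a set) \<subseteq> Pow UNIV" by simp
  moreover note A
  ultimately show "(LINT x:A|lborel. f x) = 0"
  proof (induction rule: sigma_sets_induct_disjoint)
    case (basic A)
    then show ?case using box by auto
  next
    case empty
    show ?case by (simp add: set_lebesgue_integral_def)
  next
    case (compl A)
    then have A: "A \<in> sets borel" by (simp add: borel_eq_box)
    have "(LINT x:A \<union> (UNIV - A)|lborel. f x) = (LINT x:A|lborel. f x) + (LINT x:UNIV - A|lborel. f x)"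
      using A by (intro set_integral_Un int) auto
    then show ?case
      using compl total by (simp add: set_lebesgue_integral_def)
  next
    case (union F)
    then have F: "F i \<in> sets borel" for i
      by (auto simp: borel_eq_box subset_eq)
    have "(LINT x:(\<Union>i. F i)|lborel. f x) = (\<Sum>i. LINT x:F i|lborel. f x)"
      using F union.hyps(1) by (intro lebesgue_integral_countable_add int)
        (auto simp: disjoint_family_on_def)
    then show ?case using union by simp
  qed
qed

text \<open>The claim is local: it is shown on each box whose closure lies in \<open>S\<close> by
  the vanishing of box integrals, and then transferred to \<open>S\<close> by a countable
  cover.\<close>

lemma fundamental_lemma_variations:
  fixes h :: "real^'n \<Rightarrow> real"
  assumes h: "locally_integrable S h" and S: "open S"
    and test: "\<And>\<phi>. test_function S \<phi> \<Longrightarrow> (LINT x|lebesgue_on S. h x * \<phi> x) = 0"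
  shows "AE x in lebesgue_on S. h x = 0"
proof -
  have on_box: "AE x in lebesgue. x \<in> box c d \<longrightarrow> h x = 0" if sub: "cbox c d \<subseteq> S" for c d
  proof -
    \<comment> \<open>Cutting \<open>h\<close> off to the box makes it integrable on the whole
      space, which local integrability alone does not give.\<close>
    let ?H = "\<lambda>x. indicator (box c d) x * h x"
    have "integrable lebesgue (\<lambda>x. indicator (cbox c d) x * h x)"
      using locally_integrable_cbox[OF h sub] by simp
    then have "integrable lebesgue (\<lambda>x. indicator (box c d) x *\<^sub>R (indicator (cbox c d) x * h x))"
      by (intro integrable_mult_indicator) auto
    moreover have "indicator (box c d) x *\<^sub>R (indicator (cbox c d) x * h x) = ?H x" for x
      using box_subset_cbox[of c d] by (auto simp: indicator_def)
    ultimately have H: "integrable lebesgue ?H" by (simp only:)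
    then have "?H \<in> borel_measurable lebesgue" by auto
    \<comment> \<open>The criterion with box integrals concerns \<open>lborel\<close>, whereas
      \<open>?H\<close> is only Lebesgue measurable; \<open>g\<close> is a Borel
      representative.\<close>
    then obtain g where g: "g \<in> borel_measurable lborel" "AE x in lborel. ?H x = g x"
      using completion_ex_borel_measurable_real by blast
    then have ae: "AE x in lebesgue. ?H x = g x" by (intro AE_completion)
    have g_int: "integrable lborel g"
    proof -
      have "integrable lebesgue g"
        by (rule integrable_cong_AE_imp[OF H measurable_completion[OF g(1)] ae])
      then show ?thesis using g by (simp add: integrable_completion)
    qed
    have "AE x in lborel. g x = 0"
    proof (rule AE_eq_0_if_box_integrals_eq_0[OF g_int])
      fix a b :: "real^'n"
      \<comment> \<open>Integrating the cut-off function over a box is integrating \<open>h\<close>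
        over the intersection, again a box.\<close>
      obtain e f where ef: "box a b \<inter> box c d = box e f"
        using box_Int_box by blast
      have "(LINT x:box a b|lborel. g x) = (LINT x|lebesgue. indicator (box a b) x *\<^sub>R g x)"
        using g by (simp add: set_lebesgue_integral_def integral_completion)
      also have "\<dots> = (LINT x|lebesgue. indicator (box a b) x *\<^sub>R ?H x)"
      proof (rule integral_cong_AE)
        show "AE x in lebesgue. indicator (box a b) x *\<^sub>R g x = indicator (box a b) x *\<^sub>R ?H x"
          using ae by eventually_elim simp
        show "(\<lambda>x. indicator (box a b) x *\<^sub>R ?H x) \<in> borel_measurable lebesgue"
          by (intro borel_measurable_scaleR borel_measurable_integrable[OF H] borel_measurable_indicator) simp
      qed (use g in \<open>auto intro!: borel_measurable_scaleR measurable_completion\<close>)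
      also have "\<dots> = (LINT x:box e f|lebesgue. h x)"
        unfolding set_lebesgue_integral_def ef[symmetric]
        by (intro Bochner_Integration.integral_cong) (auto simp: indicator_def)
      also have "\<dots> = 0"
      proof (cases "box e f = {}")
        case False
        \<comment> \<open>The closure of an open box is the closed box only when the open box is
          nonempty, hence the case distinction.\<close>
        then have "cbox e f \<subseteq> cbox c d"
          using closure_mono[of "box e f" "box c d"] ef closure_box[of e f]
            closure_minimal[OF box_subset_cbox closed_cbox, of c d] by blast
        then show ?thesis
          using integral_box_eq_0[OF h S test] sub by blast
      qed (simp add: set_lebesgue_integral_def)
      finally show "(LINT x:box a b|lborel. g x) = 0" .
    qed
    then have "AE x in lebesgue. g x = 0" by (intro AE_completion)
    with ae show ?thesis
      by eventually_elim (auto simp: indicator_def)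
  qed
  \<comment> \<open>The cover of \<open>S\<close> below consists of closed boxes; their faces are
    null sets.\<close>
  have on_cbox: "AE x in lebesgue. x \<in> cbox c d \<longrightarrow> h x = 0" if "cbox c d \<subseteq> S" for c d
  proof -
    have "cbox c d - box c d \<in> null_sets lebesgue"
      using negligible_frontier_interval by (simp add: negligible_iff_null_sets)
    then have "AE x in lebesgue. x \<notin> cbox c d - box c d"
      by (rule AE_not_in)
    with on_box[OF that] show ?thesis
      by eventually_elim auto
  qed
  obtain \<D> where D: "countable \<D>" "\<D> \<subseteq> Pow S" "\<And>Q. Q \<in> \<D> \<Longrightarrow> \<exists>a b. Q = cbox a b" "\<Union>\<D> = S"
    using open_countable_Union_open_cbox[OF S] by metis
  \<comment> \<open>Countability of the cover permits one exceptional null set for all its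
    boxes.\<close>
  have "AE x in lebesgue. \<forall>Q\<in>\<D>. x \<in> Q \<longrightarrow> h x = 0"
    unfolding AE_ball_countable[OF D(1)]
  proof
    fix Q assume "Q \<in> \<D>"
    then show "AE x in lebesgue. x \<in> Q \<longrightarrow> h x = 0"
      using D(2,3) on_cbox by blast
  qed
  then have "AE x in lebesgue. x \<in> S \<longrightarrow> h x = 0"
    by eventually_elim (use D(4) in blast)
  then show ?thesis
    using S by (simp add: AE_restrict_space_iff)
qed

subsection \<open>Weak gradients\<close>

lemma locally_integrable_nth:
  fixes f :: "real^'n \<Rightarrow> ('b::euclidean_space)^'k"
  shows "locally_integrable S f \<Longrightarrow> locally_integrable S (\<lambda>x. f x $ i)"
  unfolding locally_integrable_def
  by (auto intro: integrable_bounded_linear[OF bounded_linear_vec_nth])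

lemma locally_integrable_lincomb:
  "locally_integrable S f \<Longrightarrow> locally_integrable S g \<Longrightarrow>
    locally_integrable S (\<lambda>x. c *\<^sub>R f x + d *\<^sub>R g x)"
  unfolding locally_integrable_def by auto

text \<open>On \<open>K\<close> the continuous factor is bounded and \<open>f\<close> is integrable.
  \<open>K\<close> is left free so that the support of a test function also serves for its partial
  derivatives.\<close>

lemma integrable_mult_compact_support:
  fixes f \<psi> :: "real^'n \<Rightarrow> real"
  assumes f: "locally_integrable S f" and S: "open S"
    and \<psi>: "continuous_on UNIV \<psi>" and K: "compact K" "K \<subseteq> S" "\<And>x. x \<notin> K \<Longrightarrow> \<psi> x = 0"
  shows "integrable (lebesgue_on S) (\<lambda>x. f x * \<psi> x)"
proof -
  have K_sets: "K \<in> sets lebesgue"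
    using K(1) by (simp add: compact_imp_closed)
  have "integrable (lebesgue_on K) f"
    using f K by (auto simp: locally_integrable_def)
  then have int: "integrable lebesgue (\<lambda>x. indicator K x *\<^sub>R f x)"
    using K_sets by (subst (asm) integrable_restrict_space) auto
  have "bounded (\<psi> ` K)"
    using K(1) \<psi> by (intro compact_imp_bounded compact_continuous_image) (auto intro: continuous_on_subset[OF _ subset_UNIV])
  then obtain C where C: "\<And>x. x \<in> K \<Longrightarrow> \<bar>\<psi> x\<bar> \<le> C"
    by (auto simp: bounded_iff)
  have "integrable lebesgue (\<lambda>x. (indicator K x *\<^sub>R f x) * \<psi> x)"
  proof (rule Bochner_Integration.integrable_bound)
    show "integrable lebesgue (\<lambda>x. C * (indicator K x *\<^sub>R f x))"
      using int by (rule integrable_mult_right)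
    show "(\<lambda>x. (indicator K x *\<^sub>R f x) * \<psi> x) \<in> borel_measurable lebesgue"
      by (intro borel_measurable_times borel_measurable_integrable[OF int] measurable_lebesgue_continuous \<psi>)
    have "norm ((indicator K x *\<^sub>R f x) * \<psi> x) \<le> norm (C * (indicator K x *\<^sub>R f x))" for x
    proof (cases "x \<in> K")
      case True
      then have "\<bar>f x\<bar> * \<bar>\<psi> x\<bar> \<le> \<bar>f x\<bar> * \<bar>C\<bar>"
        using C[OF True] by (intro mult_left_mono) auto
      with True show ?thesis by (simp add: abs_mult mult.commute)
    qed simp
    then show "AE x in lebesgue. norm ((indicator K x *\<^sub>R f x) * \<psi> x) \<le> norm (C * (indicator K x *\<^sub>R f x))"
      by simp
  qed
  moreover have "(indicator K x *\<^sub>R f x) * \<psi> x = indicator S x *\<^sub>R (f x * \<psi> x)" for x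
    using K by (auto simp: indicator_def)
  ultimately have "integrable lebesgue (\<lambda>x. indicator S x *\<^sub>R (f x * \<psi> x))"
    by (simp only:)
  then show ?thesis
    using S by (subst integrable_restrict_space) auto
qed

lemma integrable_mult_test_function:
  assumes "locally_integrable S f" "open S" "test_function S \<phi>"
  shows "integrable (lebesgue_on S) (\<lambda>x. f x * \<phi> x)"
proof (rule integrable_mult_compact_support[OF assms(1,2)])
  show "continuous_on UNIV \<phi>"
    using assms(3) by (simp add: test_function_def C_infinity_continuous)
  show "\<phi> x = 0" if "x \<notin> closure {x. \<phi> x \<noteq> 0}" for x
    using that closure_subset[of "{x. \<phi> x \<noteq> 0}"] by auto
qed (use assms(3) in \<open>auto simp: test_function_def\<close>)

lemma integrable_mult_partial_deriv_test_function:
  assumes "locally_integrable S f" "open S" "test_function S \<phi>"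
  shows "integrable (lebesgue_on S) (\<lambda>x. f x * partial_deriv i \<phi> x)"
proof (rule integrable_mult_compact_support[OF assms(1,2)])
  show "continuous_on UNIV (partial_deriv i \<phi>)"
    using assms(3) by (simp add: test_function_def C_infinity_continuous C_infinity_partial_deriv)
  show "partial_deriv i \<phi> x = 0" if x: "x \<notin> closure {x. \<phi> x \<noteq> 0}" for x
  proof -
    \<comment> \<open>The complement of the support is open, so the line through \<open>x\<close>
      stays in it for small \<open>t\<close>; there the test function is constantly 0.\<close>
    let ?l = "\<lambda>t. x + t *\<^sub>R axis i (1::real)"
    let ?U = "?l -` (- closure {x. \<phi> x \<noteq> 0})"
    have zero: "\<phi> y = 0" if "y \<notin> closure {x. \<phi> x \<noteq> 0}" for y
      using that closure_subset[of "{x. \<phi> x \<noteq> 0}"] by auto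
    have "((\<lambda>t. 0) has_real_derivative 0) (at 0)" by simp
    then have "((\<lambda>t. \<phi> (?l t)) has_real_derivative 0) (at 0)"
    proof (rule has_field_derivative_transform_within_open[where S = ?U])
      show "open ?U"
      proof (rule open_vimage)
        show "continuous_on UNIV ?l" by (intro continuous_intros)
      qed (rule open_Compl[OF closed_closure])
      show "0 \<in> ?U" using x by simp
      show "0 = \<phi> (?l t)" if "t \<in> ?U" for t
        by (rule zero[symmetric]) (use that in simp)
    qed
    then show ?thesis
      unfolding partial_deriv_def by (rule DERIV_imp_deriv)
  qed
qed (use assms(3) in \<open>auto simp: test_function_def\<close>)

text \<open>Both gradients have the same integrals against every test function, so the fundamental
  lemma applies to the difference of each pair of entries.\<close>

lemma has_weak_grad_unique:
  assumes S: "open S" and G: "has_weak_grad S f G" and H: "has_weak_grad S f H"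
  shows "AE x in lebesgue_on S. G x = H x"
proof -
  have "AE x in lebesgue_on S. G x $ \<alpha> $ i - H x $ \<alpha> $ i = 0" for \<alpha> i
  proof (rule fundamental_lemma_variations[OF _ S])
    have loc: "locally_integrable S (\<lambda>x. G x $ \<alpha> $ i)" "locally_integrable S (\<lambda>x. H x $ \<alpha> $ i)"
      using G H by (auto simp: has_weak_grad_def intro!: locally_integrable_nth)
    from locally_integrable_lincomb[OF this, of 1 "-1"]
    show "locally_integrable S (\<lambda>x. G x $ \<alpha> $ i - H x $ \<alpha> $ i)" by simp
    fix \<phi> assume \<phi>: "test_function S \<phi>"
    have "(LINT x|lebesgue_on S. G x $ \<alpha> $ i * \<phi> x) = (LINT x|lebesgue_on S. H x $ \<alpha> $ i * \<phi> x)"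
    proof -
      have "- (LINT x|lebesgue_on S. G x $ \<alpha> $ i * \<phi> x) = - (LINT x|lebesgue_on S. H x $ \<alpha> $ i * \<phi> x)"
        using G H \<phi> unfolding has_weak_grad_def by (auto dest!: spec[of _ \<phi>])
      then show ?thesis by simp
    qed
    then show "(LINT x|lebesgue_on S. (G x $ \<alpha> $ i - H x $ \<alpha> $ i) * \<phi> x) = 0"
      using loc S \<phi> by (simp add: left_diff_distrib integrable_mult_test_function)
  qed
  \<comment> \<open>There are finitely many index pairs, so the exceptional null sets may be
    united.\<close>
  then have "AE x in lebesgue_on S. \<forall>\<alpha> i. G x $ \<alpha> $ i - H x $ \<alpha> $ i = 0"
    by (intro eventually_all_finite)
  then show ?thesis
    by eventually_elim (simp add: vec_eq_iff)
qed

text \<open>Splitting the integrals requires each product to be integrable, which compact support of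
  the test function ensures.\<close>

lemma has_weak_grad_lincomb:
  assumes S: "open S" and f: "has_weak_grad S f F" and g: "has_weak_grad S g G"
  shows "has_weak_grad S (\<lambda>x. c *\<^sub>R f x + d *\<^sub>R g x) (\<lambda>x. c *\<^sub>R F x + d *\<^sub>R G x)"
  unfolding has_weak_grad_def
proof (intro conjI allI impI)
  have loc: "locally_integrable S f" "locally_integrable S F" "locally_integrable S g" "locally_integrable S G"
    using f g by (auto simp: has_weak_grad_def)
  then show "locally_integrable S (\<lambda>x. c *\<^sub>R f x + d *\<^sub>R g x)"
    "locally_integrable S (\<lambda>x. c *\<^sub>R F x + d *\<^sub>R G x)"
    by (simp_all add: locally_integrable_lincomb)
  fix \<phi> \<alpha> i assume \<phi>: "test_function S \<phi>"
  have loc': "locally_integrable S (\<lambda>x. f x $ \<alpha>)" "locally_integrable S (\<lambda>x. g x $ \<alpha>)"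
    "locally_integrable S (\<lambda>x. F x $ \<alpha> $ i)" "locally_integrable S (\<lambda>x. G x $ \<alpha> $ i)"
    using loc by (auto intro!: locally_integrable_nth)
  have "(LINT x|lebesgue_on S. (c *\<^sub>R f x + d *\<^sub>R g x) $ \<alpha> * partial_deriv i \<phi> x) =
      (LINT x|lebesgue_on S. c * (f x $ \<alpha> * partial_deriv i \<phi> x) + d * (g x $ \<alpha> * partial_deriv i \<phi> x))"
    by (simp add: algebra_simps)
  also have "\<dots> = c * (LINT x|lebesgue_on S. f x $ \<alpha> * partial_deriv i \<phi> x) +
      d * (LINT x|lebesgue_on S. g x $ \<alpha> * partial_deriv i \<phi> x)"
    using loc' S \<phi> by (simp add: integrable_mult_partial_deriv_test_function)
  also have "\<dots> = - (c * (LINT x|lebesgue_on S. F x $ \<alpha> $ i * \<phi> x) +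
      d * (LINT x|lebesgue_on S. G x $ \<alpha> $ i * \<phi> x))"
    using f g \<phi> by (simp add: has_weak_grad_def)
  also have "\<dots> = - (LINT x|lebesgue_on S. c * (F x $ \<alpha> $ i * \<phi> x) + d * (G x $ \<alpha> $ i * \<phi> x))"
    using loc' S \<phi> by (simp add: integrable_mult_test_function)
  also have "\<dots> = - (LINT x|lebesgue_on S. (c *\<^sub>R F x + d *\<^sub>R G x) $ \<alpha> $ i * \<phi> x)"
    by (simp add: algebra_simps)
  finally show "(LINT x|lebesgue_on S. (c *\<^sub>R f x + d *\<^sub>R g x) $ \<alpha> * partial_deriv i \<phi> x) =
    - (LINT x|lebesgue_on S. (c *\<^sub>R F x + d *\<^sub>R G x) $ \<alpha> $ i * \<phi> x)" .
qed

lemma has_weak_grad_grad: "has_weak_grad S f G \<Longrightarrow> has_weak_grad S f (grad S f)"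
  unfolding grad_def by (rule someI[of "has_weak_grad S f"])

text \<open>\<open>grad\<close> chooses a representative for each function separately, so linearity
  can be expected almost everywhere only; it follows from uniqueness.\<close>

lemma grad_lincomb_AE:
  assumes "open S" "has_weak_grad S f F" "has_weak_grad S g G"
  shows "AE x in lebesgue_on S.
    grad S (\<lambda>x. c *\<^sub>R f x + d *\<^sub>R g x) x = c *\<^sub>R grad S f x + d *\<^sub>R grad S g x"
proof -
  have "has_weak_grad S (\<lambda>x. c *\<^sub>R f x + d *\<^sub>R g x) (\<lambda>x. c *\<^sub>R grad S f x + d *\<^sub>R grad S g x)"
    using assms by (intro has_weak_grad_lincomb has_weak_grad_grad)
  from has_weak_grad_unique[OF assms(1) has_weak_grad_grad[OF this] this]
  show ?thesis .
qed

text \<open>Completeness of Lebesgue measure makes measurability stable under changes on null sets.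
  It is how the arbitrarily chosen \<open>grad\<close> inherits measurability.\<close>

lemma borel_measurable_lebesgue_on_AE:
  fixes f g :: "'a::euclidean_space \<Rightarrow> 'b::euclidean_space"
  assumes S: "S \<in> sets lebesgue" and f: "f \<in> borel_measurable (lebesgue_on S)"
    and ae: "AE x in lebesgue_on S. f x = g x"
  shows "g \<in> borel_measurable (lebesgue_on S)"
proof -
  have iff: "h \<in> borel_measurable (lebesgue_on S) \<longleftrightarrow> (\<lambda>x. indicator S x *\<^sub>R h x) \<in> borel_measurable lebesgue"
    for h :: "'a \<Rightarrow> 'b"
    using S by (intro borel_measurable_restrict_space_iff) auto
  have "AE x in lebesgue. indicator S x *\<^sub>R f x = indicator S x *\<^sub>R g x"
    using ae S by (auto simp: AE_restrict_space_iff indicator_def)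
  from borel_measurable_AE[OF f[unfolded iff] this] show ?thesis
    unfolding iff .
qed

text \<open>\<open>W1inf\<close> provides some bounded weak gradient; the chosen one agrees with it
  almost everywhere.\<close>

lemma grad_in_Linf:
  assumes S: "open S" and f: "f \<in> W1inf S"
  shows "grad S f \<in> Linf S"
proof -
  obtain G where G: "G \<in> Linf S" "has_weak_grad S f G"
    using f by (auto simp: W1inf_def)
  have ae: "AE x in lebesgue_on S. G x = grad S f x"
    by (rule has_weak_grad_unique[OF S G(2) has_weak_grad_grad[OF G(2)]])
  obtain C where "AE x in lebesgue_on S. norm (G x) \<le> C"
    using G(1) by (auto simp: Linf_def)
  with ae have "AE x in lebesgue_on S. norm (grad S f x) \<le> C"
    by eventually_elim simp
  moreover have "grad S f \<in> borel_measurable (lebesgue_on S)"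
    by (rule borel_measurable_lebesgue_on_AE[OF _ _ ae]) (use S G(1) in \<open>auto simp: Linf_def\<close>)
  ultimately show ?thesis by (auto simp: Linf_def)
qed

subsection \<open>Square-integrable fields\<close>

lemma L2_lincomb:
  assumes f: "f \<in> L2 S" and g: "g \<in> L2 S"
  shows "(\<lambda>x. c *\<^sub>R f x + d *\<^sub>R g x) \<in> L2 S"
proof -
  have [measurable]: "f \<in> borel_measurable (lebesgue_on S)" "g \<in> borel_measurable (lebesgue_on S)"
    and int: "integrable (lebesgue_on S) (\<lambda>x. (norm (f x))\<^sup>2)" "integrable (lebesgue_on S) (\<lambda>x. (norm (g x))\<^sup>2)"
    using f g by (auto simp: L2_def)
  have bound: "(norm (c *\<^sub>R v + d *\<^sub>R w))\<^sup>2 \<le> 2 * c\<^sup>2 * (norm v)\<^sup>2 + 2 * d\<^sup>2 * (norm w)\<^sup>2" for v w :: 'b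
  proof -
    \<comment> \<open>Parallelogram identity for the two scaled vectors; dropping the second square
      gives the bound.\<close>
    have "(norm (c *\<^sub>R v + d *\<^sub>R w))\<^sup>2 + (norm (c *\<^sub>R v - d *\<^sub>R w))\<^sup>2 =
        2 * c\<^sup>2 * (norm v)\<^sup>2 + 2 * d\<^sup>2 * (norm w)\<^sup>2"
      by (simp add: power2_norm_eq_inner inner_simps power2_eq_square[of c] power2_eq_square[of d] algebra_simps)
    then show ?thesis using zero_le_power2[of "norm (c *\<^sub>R v - d *\<^sub>R w)"] by linarith
  qed
  have "integrable (lebesgue_on S) (\<lambda>x. (norm (c *\<^sub>R f x + d *\<^sub>R g x))\<^sup>2)"
  proof (rule Bochner_Integration.integrable_bound)
    show "integrable (lebesgue_on S) (\<lambda>x. 2 * c\<^sup>2 * (norm (f x))\<^sup>2 + 2 * d\<^sup>2 * (norm (g x))\<^sup>2)"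
      using int by (intro Bochner_Integration.integrable_add integrable_mult_right)
    show "AE x in lebesgue_on S. norm ((norm (c *\<^sub>R f x + d *\<^sub>R g x))\<^sup>2)
        \<le> norm (2 * c\<^sup>2 * (norm (f x))\<^sup>2 + 2 * d\<^sup>2 * (norm (g x))\<^sup>2)"
      using bound by (intro AE_I2) (simp add: abs_of_nonneg)
  qed measurable
  then show ?thesis by (simp add: L2_def)
qed

lemma L2_inner_integrable:
  assumes f: "f \<in> L2 S" and g: "g \<in> L2 S"
  shows "integrable (lebesgue_on S) (\<lambda>x. f x \<bullet> g x)"
proof -
  have [measurable]: "f \<in> borel_measurable (lebesgue_on S)" "g \<in> borel_measurable (lebesgue_on S)"
    and int: "integrable (lebesgue_on S) (\<lambda>x. (norm (f x))\<^sup>2)" "integrable (lebesgue_on S) (\<lambda>x. (norm (g x))\<^sup>2)"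
    using f g by (auto simp: L2_def)
  show ?thesis
  proof (rule Bochner_Integration.integrable_bound)
    show "integrable (lebesgue_on S) (\<lambda>x. (norm (f x))\<^sup>2 + (norm (g x))\<^sup>2)"
      using int by (rule Bochner_Integration.integrable_add)
    have "norm (v \<bullet> w) \<le> norm ((norm v)\<^sup>2 + (norm w)\<^sup>2)" for v w :: 'b
    proof -
      have "\<bar>v \<bullet> w\<bar> \<le> norm v * norm w" by (rule Cauchy_Schwarz_ineq2)
      also have "\<dots> \<le> (norm v)\<^sup>2 + (norm w)\<^sup>2"
        using sum_squares_bound[of "norm v" "norm w"] norm_ge_zero[of v] norm_ge_zero[of w]
          mult_nonneg_nonneg[of "norm v" "norm w"] by linarith
      finally show ?thesis by simp
    qed
    then show "AE x in lebesgue_on S. norm (f x \<bullet> g x) \<le> norm ((norm (f x))\<^sup>2 + (norm (g x))\<^sup>2)"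
      by (intro AE_I2)
  qed measurable
qed

lemma H1_lincomb:
  assumes "open S" "f \<in> H1 S" "g \<in> H1 S"
  shows "(\<lambda>x. c *\<^sub>R f x + d *\<^sub>R g x) \<in> H1 S"
proof -
  obtain F G where "F \<in> L2 S" "has_weak_grad S f F" "G \<in> L2 S" "has_weak_grad S g G"
    using assms by (auto simp: H1_def)
  then have "(\<lambda>x. c *\<^sub>R F x + d *\<^sub>R G x) \<in> L2 S"
    "has_weak_grad S (\<lambda>x. c *\<^sub>R f x + d *\<^sub>R g x) (\<lambda>x. c *\<^sub>R F x + d *\<^sub>R G x)"
    using assms(1) by (simp_all add: L2_lincomb has_weak_grad_lincomb)
  moreover have "(\<lambda>x. c *\<^sub>R f x + d *\<^sub>R g x) \<in> L2 S"
    using assms by (simp add: H1_def L2_lincomb)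
  ultimately show ?thesis by (auto simp: H1_def)
qed

lemma L2_norm_power2: "(L2_norm S f)\<^sup>2 = L2_inner S f f"
  by (simp add: L2_norm_def L2_inner_def Bochner_Integration.integral_nonneg)

text \<open>Pointwise, 2 (a - b) \<bullet> a exceeds a \<bullet> a - b \<bullet> b by the square of
  a - b, the numerical dissipation of the implicit Euler step. It serves for the fluid velocity and
  for the structure velocity.\<close>

lemma L2_inner_difference_quotient_ge:
  assumes t: "t > 0" and f: "f \<in> L2 S" and g: "g \<in> L2 S"
  shows "L2_inner S (\<lambda>x. (f x - g x) /\<^sub>R t) f \<ge> ((L2_norm S f)\<^sup>2 - (L2_norm S g)\<^sup>2) / (2 * t)"
proof -
  have int: "integrable (lebesgue_on S) (\<lambda>x. f x \<bullet> f x)" "integrable (lebesgue_on S) (\<lambda>x. g x \<bullet> g x)"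
    using f g by (simp_all add: L2_inner_integrable)
  have diff: "(\<lambda>x. (f x - g x) /\<^sub>R t) \<in> L2 S"
    using L2_lincomb[OF f g, of "inverse t" "- inverse t"] by (simp add: scaleR_diff_right)
  have "((L2_norm S f)\<^sup>2 - (L2_norm S g)\<^sup>2) / (2 * t) =
      (LINT x|lebesgue_on S. (f x \<bullet> f x - g x \<bullet> g x) / (2 * t))"
    using int by (simp add: L2_norm_power2 L2_inner_def)
  also have "\<dots> \<le> L2_inner S (\<lambda>x. (f x - g x) /\<^sub>R t) f"
    unfolding L2_inner_def
  proof (rule integral_mono)
    show "integrable (lebesgue_on S) (\<lambda>x. (f x \<bullet> f x - g x \<bullet> g x) / (2 * t))"
      using int by simp
    show "integrable (lebesgue_on S) (\<lambda>x. ((f x - g x) /\<^sub>R t) \<bullet> f x)"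
      using diff f by (rule L2_inner_integrable)
    fix x
    have "f x \<bullet> f x - g x \<bullet> g x \<le> 2 * ((f x - g x) \<bullet> f x)"
      using inner_ge_zero[of "f x - g x"] by (simp add: inner_simps inner_commute)
    then show "(f x \<bullet> f x - g x \<bullet> g x) / (2 * t) \<le> ((f x - g x) /\<^sub>R t) \<bullet> f x"
      using t by (simp add: divide_simps mult.commute)
  qed
  finally show ?thesis .
qed

subsection \<open>Convex elastic energies\<close>

text \<open>The stress is defined entrywise by directional derivatives; total differentiability
  makes it represent the derivative through the Frobenius product.\<close>

lemma C1_density_has_derivative:
  assumes "C1_density W"
  shows "(W has_derivative (\<lambda>H. piola_kirchhoff W F \<bullet> H)) (at F)"
proof -
  obtain D where D: "(W has_derivative D) (at F)"
    using assms by (auto simp: C1_density_def differentiable_def)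
  then have lin: "linear D"
    by (rule has_derivative_linear)
  have "deriv (\<lambda>t. W (F + t *\<^sub>R E)) 0 = D E" for E
  proof -
    have "(W has_derivative D) (at (F + 0 *\<^sub>R E))" using D by simp
    then have "((\<lambda>t. W (F + t *\<^sub>R E)) has_derivative (\<lambda>t. D (t *\<^sub>R E))) (at 0)"
      by (rule has_derivative_compose[rotated]) (auto intro!: derivative_eq_intros)
    then have "((\<lambda>t. W (F + t *\<^sub>R E)) has_real_derivative D E) (at 0)"
      unfolding has_field_derivative_def by (simp add: linear_scale[OF lin] mult_commute_abs)
    then show ?thesis by (rule DERIV_imp_deriv)
  qed
  then have "piola_kirchhoff W F $ \<alpha> $ i = D (axis \<alpha> (axis i 1))" for \<alpha> i
    by (simp add: piola_kirchhoff_def)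
  \<comment> \<open>\<open>adjoint D 1\<close> is the Riesz vector of the functional
    \<open>D\<close>; its entries are the values of \<open>D\<close> on the matrix units.\<close>
  moreover have adj: "D H = adjoint D 1 \<bullet> H" for H
    using adjoint_works[OF lin, of H 1] by (simp add: inner_commute)
  ultimately have "piola_kirchhoff W F = adjoint D 1"
    by (simp add: vec_eq_iff inner_axis)
  moreover have "D = (\<lambda>H. adjoint D 1 \<bullet> H)"
    by (rule ext) (rule adj)
  ultimately show ?thesis
    using D by (simp only:)
qed

text \<open>Restricted to the line from \<open>G\<close> to \<open>F\<close>, the density is a
  convex function of one real variable; its tangent at 0 is compared with its value at 1.\<close>

lemma convex_density_above_tangent:
  assumes W: "C1_density W" and convex: "convex_on UNIV W"
  shows "W G + piola_kirchhoff W G \<bullet> (F - G) \<le> W F"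
proof -
  let ?w = "\<lambda>t::real. W (G + t *\<^sub>R (F - G))"
  have "convex_on UNIV ?w"
  proof (rule convex_onI)
    fix t x y :: real assume "0 < t" "t < 1"
    then have "W ((1 - t) *\<^sub>R (G + x *\<^sub>R (F - G)) + t *\<^sub>R (G + y *\<^sub>R (F - G))) \<le>
        (1 - t) * ?w x + t * ?w y"
      by (intro convex_onD[OF convex]) auto
    moreover have "(1 - t) *\<^sub>R (G + x *\<^sub>R (F - G)) + t *\<^sub>R (G + y *\<^sub>R (F - G)) =
        G + ((1 - t) *\<^sub>R x + t *\<^sub>R y) *\<^sub>R (F - G)"
      by (simp add: algebra_simps)
    ultimately show "?w ((1 - t) *\<^sub>R x + t *\<^sub>R y) \<le> (1 - t) * ?w x + t * ?w y"
      by (simp only:)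
  qed simp
  moreover have "(?w has_real_derivative piola_kirchhoff W G \<bullet> (F - G)) (at 0)"
  proof -
    have "(W has_derivative (\<lambda>H. piola_kirchhoff W G \<bullet> H)) (at (G + 0 *\<^sub>R (F - G)))"
      using C1_density_has_derivative[OF W] by simp
    then have "(?w has_derivative (\<lambda>t. piola_kirchhoff W G \<bullet> (t *\<^sub>R (F - G)))) (at 0)"
      by (rule has_derivative_compose[rotated]) (auto intro!: derivative_eq_intros)
    then show ?thesis
      unfolding has_field_derivative_def by (simp add: mult_commute_abs)
  qed
  ultimately have "piola_kirchhoff W G \<bullet> (F - G) * (1 - 0) \<le> ?w 1 - ?w 0"
    by (intro convex_on_imp_above_tangent[where A = UNIV]) auto
  then show ?thesis by simp
qed

section \<open>Essentially bounded fields and the elastic energy inequality\<close>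

lemma Linf_integrable:
  assumes "bounded_domain S" and f: "f \<in> Linf S"
  shows "integrable (lebesgue_on S) f"
proof -
  have "S \<in> lmeasurable"
    using assms(1) by (simp add: bounded_domain_def bounded_set_imp_lmeasurable)
  then interpret finite_measure "lebesgue_on S"
    by (rule finite_measure_lebesgue_on)
  show ?thesis
    using f integrable_const_bound by (auto simp: Linf_def)
qed

text \<open>A continuous function is bounded on the compact ball containing almost all values of
  \<open>f\<close>. Applied to the density and the stress, this gives integrability without any
  growth condition on \<open>W\<close>.\<close>

lemma continuous_on_comp_Linf:
  fixes f :: "real^'m \<Rightarrow> 'b::euclidean_space" and w :: "'b \<Rightarrow> 'c::euclidean_space"
  assumes w: "continuous_on UNIV w" and f: "f \<in> Linf S"
  shows "(\<lambda>x. w (f x)) \<in> Linf S"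
proof -
  obtain C where C: "AE x in lebesgue_on S. norm (f x) \<le> C"
    using f by (auto simp: Linf_def)
  have "bounded (w ` cball 0 C)"
    using w by (intro compact_imp_bounded compact_continuous_image) (auto intro: continuous_on_subset[OF _ subset_UNIV])
  then obtain K where K: "\<And>y. norm y \<le> C \<Longrightarrow> norm (w y) \<le> K"
    by (force simp: bounded_iff)
  from C have "AE x in lebesgue_on S. norm (w (f x)) \<le> K"
    by eventually_elim (rule K)
  moreover have "(\<lambda>x. w (f x)) \<in> borel_measurable (lebesgue_on S)"
    using f w by (auto simp: Linf_def intro: measurable_compose[OF _ borel_measurable_continuous_onI])
  ultimately show ?thesis by (auto simp: Linf_def)
qed

lemma Linf_inner:
  assumes f: "f \<in> Linf S" and g: "g \<in> Linf S"
  shows "(\<lambda>x. f x \<bullet> g x) \<in> Linf S"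
proof -
  obtain C D where "AE x in lebesgue_on S. norm (f x) \<le> C" "AE x in lebesgue_on S. norm (g x) \<le> D"
    using f g by (auto simp: Linf_def)
  then have "AE x in lebesgue_on S. norm (f x \<bullet> g x) \<le> C * D"
  proof eventually_elim
    case (elim x)
    have "norm (f x \<bullet> g x) \<le> norm (f x) * norm (g x)"
      using Cauchy_Schwarz_ineq2 by simp
    also have "\<dots> \<le> C * D"
      using elim by (meson mult_mono norm_ge_zero order_trans)
    finally show ?case .
  qed
  then show ?thesis using f g by (auto simp: Linf_def)
qed

text \<open>This integrates the tangent inequality based at the gradient of \<open>X\<close>, the
  new deformation, since the stress is evaluated implicitly. Boundedness of both gradients makes all
  integrands integrable.\<close>

lemma L2_inner_piola_kirchhoff_ge:
  fixes X Z :: "real^'m \<Rightarrow> real^'d"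
  assumes B: "bounded_domain B" and W: "C1_density W" "convex_on UNIV W"
    and X: "X \<in> W1inf B" and Z: "Z \<in> W1inf B" and t: "t > 0"
  shows "L2_inner B (\<lambda>s. piola_kirchhoff W (grad B X s)) (grad B (\<lambda>s. (X s - Z s) /\<^sub>R t)) \<ge>
    (elastic_energy B W X - elastic_energy B W Z) / t"
proof -
  have S: "open B" using B by (simp add: bounded_domain_def)
  let ?P = "\<lambda>s. piola_kirchhoff W (grad B X s)"
  have gr: "grad B X \<in> Linf B" "grad B Z \<in> Linf B"
    using S X Z by (auto intro: grad_in_Linf)
  have P: "?P \<in> Linf B"
    using W(1) by (intro continuous_on_comp_Linf[OF _ gr(1)]) (simp add: C1_density_def)
  have cont: "continuous_on UNIV W"
    using W(1) by (intro continuous_at_imp_continuous_on ballI differentiable_imp_continuous_within)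
      (simp add: C1_density_def)
  have intW: "integrable (lebesgue_on B) (\<lambda>s. W (grad B X s))"
    "integrable (lebesgue_on B) (\<lambda>s. W (grad B Z s))"
    by (rule Linf_integrable[OF B continuous_on_comp_Linf[OF cont gr(1)]]
        Linf_integrable[OF B continuous_on_comp_Linf[OF cont gr(2)]])+
  have intP: "integrable (lebesgue_on B) (\<lambda>s. ?P s \<bullet> grad B X s)"
    "integrable (lebesgue_on B) (\<lambda>s. ?P s \<bullet> grad B Z s)"
    by (rule Linf_integrable[OF B Linf_inner[OF P gr(1)]] Linf_integrable[OF B Linf_inner[OF P gr(2)]])+
  obtain G H where GH: "has_weak_grad B X G" "has_weak_grad B Z H"
    using X Z by (auto simp: W1inf_def)
  have gY: "AE s in lebesgue_on B. grad B (\<lambda>s. (X s - Z s) /\<^sub>R t) s = (grad B X s - grad B Z s) /\<^sub>R t"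
    using grad_lincomb_AE[OF S GH, of "inverse t" "- inverse t"] by (simp add: scaleR_diff_right)
  have [measurable]: "?P \<in> borel_measurable (lebesgue_on B)" "grad B X \<in> borel_measurable (lebesgue_on B)"
    "grad B Z \<in> borel_measurable (lebesgue_on B)"
    using P gr by (auto simp: Linf_def)
  \<comment> \<open>\<open>integral_cong_AE\<close> below requires both integrands to be measurable;
    the chosen gradient of the quotient is so because it equals this function almost
    everywhere.\<close>
  have "(\<lambda>s. (grad B X s - grad B Z s) /\<^sub>R t) \<in> borel_measurable (lebesgue_on B)"
    by measurable
  then have [measurable]: "grad B (\<lambda>s. (X s - Z s) /\<^sub>R t) \<in> borel_measurable (lebesgue_on B)"
    by (rule borel_measurable_lebesgue_on_AE[rotated]) (use S gY in auto)
  have "(elastic_energy B W X - elastic_energy B W Z) / t =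
      (LINT s|lebesgue_on B. (W (grad B X s) - W (grad B Z s)) / t)"
    using intW by (simp add: elastic_energy_def)
  also have "\<dots> \<le> (LINT s|lebesgue_on B. (?P s \<bullet> grad B X s - ?P s \<bullet> grad B Z s) / t)"
  proof (rule integral_mono)
    fix s
    have "W (grad B X s) - W (grad B Z s) \<le> ?P s \<bullet> grad B X s - ?P s \<bullet> grad B Z s"
      using convex_density_above_tangent[OF W, of "grad B X s" "grad B Z s"] by (simp add: inner_simps)
    then show "(W (grad B X s) - W (grad B Z s)) / t \<le> (?P s \<bullet> grad B X s - ?P s \<bullet> grad B Z s) / t"
      using t by (simp add: divide_right_mono)
  qed (use intW intP in auto)
  also have "\<dots> = L2_inner B ?P (grad B (\<lambda>s. (X s - Z s) /\<^sub>R t))"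
    unfolding L2_inner_def
  proof (rule integral_cong_AE)
    show "AE s in lebesgue_on B. (?P s \<bullet> grad B X s - ?P s \<bullet> grad B Z s) / t =
        ?P s \<bullet> grad B (\<lambda>s. (X s - Z s) /\<^sub>R t) s"
      using gY by eventually_elim (simp add: inner_diff_right divide_inverse mult.commute)
  qed measurable
  finally show ?thesis .
qed

section \<open>The discrete energy inequality over one time step\<close>

theorem proposition3:
  fixes \<Omega> :: "(real^'d) set" and B :: "(real^'m) set"
    and \<rho>f \<nu> \<delta>\<rho> T \<Delta>t :: real and N :: nat
    and W :: "real^'m^'d \<Rightarrow> real"
    and \<Lambda> :: "('d, 'm) multiplier set"
    and M1 M2 :: "(real^'m \<Rightarrow> real^'d) set"
    and c1 c2 :: "('d, 'm) multiplier \<Rightarrow> (real^'m \<Rightarrow> real^'d) \<Rightarrow> real"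
    and u0 :: "real^'d \<Rightarrow> real^'d" and X0 :: "real^'m \<Rightarrow> real^'d"
    and u :: "int \<Rightarrow> real^'d \<Rightarrow> real^'d"
    and p :: "int \<Rightarrow> real^'d \<Rightarrow> real"
    and X :: "int \<Rightarrow> real^'m \<Rightarrow> real^'d"
    and lam :: "int \<Rightarrow> ('d, 'm) multiplier"
  assumes dim_d: "CARD('d) \<in> {2, 3}"
    and dim_m: "CARD('m) = CARD('d) \<or> CARD('m) + 1 = CARD('d)"
    and fluid_domain: "bounded_domain \<Omega>" "lipschitz_boundary \<Omega>"
    and solid_domain: "bounded_domain B"
    and constants: "\<rho>f > 0" "\<nu> > 0" "\<delta>\<rho> \<ge> 0"
    and time: "T > 0" "N > 0" "\<Delta>t = T / real N"
    and W_positive: "\<And>F. W F \<ge> 0"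
    and W_C1: "C1_density W"
    and W_convex: "convex_on UNIV W"
    and coupling: "coupling_setting B \<Lambda> M1 M2 c1 c2"
    and initial_data: "u0 \<in> H10 \<Omega>" "X0 \<in> W1inf B" "X (-1) \<in> H1 B"
    and u_space: "\<And>n. n \<in> {0..int N} \<Longrightarrow> u n \<in> H10 \<Omega>"
    and X_space: "\<And>n. n \<in> {0..int N} \<Longrightarrow> X n \<in> H1 B"
    and p_space: "\<And>n. n \<in> {1..int N} \<Longrightarrow> p n \<in> L2_zero_mean \<Omega>"
    and lam_space: "\<And>n. n \<in> {1..int N} \<Longrightarrow> lam n \<in> \<Lambda>"
    and u_init: "AE x in lebesgue_on \<Omega>. u 0 x = u0 x"
    and X_init: "AE s in lebesgue_on B. X 0 s = X0 s"
    and momentum: "\<And>n v. n \<in> {0..<int N} \<Longrightarrow> v \<in> H10 \<Omega> \<Longrightarrow>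
        \<rho>f * L2_inner \<Omega> (\<lambda>x. (u (n + 1) x - u n x) /\<^sub>R \<Delta>t) v
          + b_form \<Omega> \<rho>f (u n) (u (n + 1)) v + a_form \<Omega> \<nu> (u (n + 1)) v
          - L2_inner \<Omega> (divergence \<Omega> v) (p (n + 1))
          + c1 (lam (n + 1)) (eval_along \<Omega> B (X n) v) = 0"
    and incompressibility: "\<And>n q. n \<in> {0..<int N} \<Longrightarrow> q \<in> L2_zero_mean \<Omega> \<Longrightarrow>
        L2_inner \<Omega> (divergence \<Omega> (u (n + 1))) q = 0"
    and structure_eq: "\<And>n Y. n \<in> {0..<int N} \<Longrightarrow> Y \<in> H1 B \<Longrightarrow>
        \<delta>\<rho> * L2_inner B (\<lambda>s. (X (n + 1) s - 2 *\<^sub>R X n s + X (n - 1) s) /\<^sub>R \<Delta>t\<^sup>2) Y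
          + L2_inner B (\<lambda>s. piola_kirchhoff W (grad B (X (n + 1)) s)) (grad B Y)
          - c2 (lam (n + 1)) Y = 0"
    and kinematic: "\<And>n \<mu>. n \<in> {0..<int N} \<Longrightarrow> \<mu> \<in> \<Lambda> \<Longrightarrow>
        c1 \<mu> (eval_along \<Omega> B (X n) (u (n + 1)))
          - c2 \<mu> (\<lambda>s. (X (n + 1) s - X n s) /\<^sub>R \<Delta>t) = 0"
    and X_regular: "\<And>n. n \<in> {0..int N} \<Longrightarrow> X n \<in> W1inf B"
    and X_eval: "\<And>n. n \<in> {0..<int N} \<Longrightarrow> eval_well_defined \<Omega> B M1 (X n)"
  shows "\<forall>n\<in>{0..<int N}.
      \<rho>f / (2 * \<Delta>t) * ((L2_norm \<Omega> (u (n + 1)))\<^sup>2 - (L2_norm \<Omega> (u n))\<^sup>2)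
      + \<nu> * (L2_norm \<Omega> (grad_sym \<Omega> (u (n + 1))))\<^sup>2
      + \<delta>\<rho> / (2 * \<Delta>t) *
          ((L2_norm B (\<lambda>s. (X (n + 1) s - X n s) /\<^sub>R \<Delta>t))\<^sup>2
            - (L2_norm B (\<lambda>s. (X n s - X (n - 1) s) /\<^sub>R \<Delta>t))\<^sup>2)
      + (elastic_energy B W (X (n + 1)) - elastic_energy B W (X n)) / \<Delta>t \<le> 0"
proof
  fix n assume n: "n \<in> {0..<int N}"
  then have n0: "n \<in> {0..int N}" and n1: "n + 1 \<in> {0..int N}" and n1': "n + 1 \<in> {1..int N}"
    by auto
  have t: "\<Delta>t > 0" using time by simp
  have B: "open B" using solid_domain by (simp add: bounded_domain_def)
  let ?u = "u (n + 1)" and ?X = "X (n + 1)"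
  let ?Y = "\<lambda>s. (X (n + 1) s - X n s) /\<^sub>R \<Delta>t" and ?Y' = "\<lambda>s. (X n s - X (n - 1) s) /\<^sub>R \<Delta>t"
  have u_H10: "?u \<in> H10 \<Omega>" and u_L2: "?u \<in> L2 \<Omega>" "u n \<in> L2 \<Omega>"
    using u_space[OF n1] u_space[OF n0] by (auto simp: H10_def H1_def)
  \<comment> \<open>For n = 0 the previous deformation is the prescribed starting value
    \<open>X (-1)\<close>.\<close>
  have X_prev: "X (n - 1) \<in> H1 B"
    using n initial_data(3) X_space[of "n - 1"] by (cases "n = 0") auto
  have Y: "?Y \<in> H1 B"
    using H1_lincomb[OF B X_space[OF n1] X_space[OF n0], of "inverse \<Delta>t" "- inverse \<Delta>t"]
    by (simp add: scaleR_diff_right)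
  have "?Y' \<in> H1 B"
    using H1_lincomb[OF B X_space[OF n0] X_prev, of "inverse \<Delta>t" "- inverse \<Delta>t"]
    by (simp add: scaleR_diff_right)
  with Y have Y_L2: "?Y \<in> L2 B" "?Y' \<in> L2 B"
    by (auto simp: H1_def)

  \<comment> \<open>With the new velocity as test function the two halves of \<open>b_form\<close>
    coincide and cancel. The choice q = \<open>p (n + 1)\<close> removes the pressure, and \<mu> =
    \<open>lam (n + 1)\<close> trades \<open>c1\<close> at the velocity for \<open>c2\<close> at
    \<open>?Y\<close>.\<close>
  have fluid: "\<rho>f * L2_inner \<Omega> (\<lambda>x. (?u x - u n x) /\<^sub>R \<Delta>t) ?u
      + \<nu> * (L2_norm \<Omega> (grad_sym \<Omega> ?u))\<^sup>2 + c2 (lam (n + 1)) ?Y = 0"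
    using momentum[OF n u_H10] incompressibility[OF n p_space[OF n1']] kinematic[OF n lam_space[OF n1']]
    by (simp add: a_form_def b_form_def L2_norm_power2)
  \<comment> \<open>The second difference is the difference quotient of the consecutive structure
    velocities \<open>?Y'\<close> and \<open>?Y\<close>, so the inertial term is treated like the
    fluid one.\<close>
  have "(\<lambda>s. (X (n + 1) s - 2 *\<^sub>R X n s + X (n - 1) s) /\<^sub>R \<Delta>t\<^sup>2) = (\<lambda>s. (?Y s - ?Y' s) /\<^sub>R \<Delta>t)"
    by (simp add: power2_eq_square scaleR_2 algebra_simps)
  then have solid: "\<delta>\<rho> * L2_inner B (\<lambda>s. (?Y s - ?Y' s) /\<^sub>R \<Delta>t) ?Y
      + L2_inner B (\<lambda>s. piola_kirchhoff W (grad B ?X s)) (grad B ?Y) - c2 (lam (n + 1)) ?Y = 0"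
    using structure_eq[OF n Y] by (simp only:)

  have "\<rho>f / (2 * \<Delta>t) * ((L2_norm \<Omega> ?u)\<^sup>2 - (L2_norm \<Omega> (u n))\<^sup>2)
      \<le> \<rho>f * L2_inner \<Omega> (\<lambda>x. (?u x - u n x) /\<^sub>R \<Delta>t) ?u"
    using mult_left_mono[OF L2_inner_difference_quotient_ge[OF t u_L2], of \<rho>f] constants(1) by simp
  moreover have "\<delta>\<rho> / (2 * \<Delta>t) * ((L2_norm B ?Y)\<^sup>2 - (L2_norm B ?Y')\<^sup>2)
      \<le> \<delta>\<rho> * L2_inner B (\<lambda>s. (?Y s - ?Y' s) /\<^sub>R \<Delta>t) ?Y"
    using mult_left_mono[OF L2_inner_difference_quotient_ge[OF t Y_L2] constants(3)] by simp
  moreover have "(elastic_energy B W ?X - elastic_energy B W (X n)) / \<Delta>t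
      \<le> L2_inner B (\<lambda>s. piola_kirchhoff W (grad B ?X s)) (grad B ?Y)"
    by (rule L2_inner_piola_kirchhoff_ge[OF solid_domain W_C1 W_convex X_regular[OF n1] X_regular[OF n0] t])
  ultimately show "\<rho>f / (2 * \<Delta>t) * ((L2_norm \<Omega> ?u)\<^sup>2 - (L2_norm \<Omega> (u n))\<^sup>2)
      + \<nu> * (L2_norm \<Omega> (grad_sym \<Omega> ?u))\<^sup>2
      + \<delta>\<rho> / (2 * \<Delta>t) * ((L2_norm B ?Y)\<^sup>2 - (L2_norm B ?Y')\<^sup>2)
      + (elastic_energy B W ?X - elastic_energy B W (X n)) / \<Delta>t \<le> 0"
    \<comment> \<open>In the sum of both identities the \<open>c2\<close> terms cancel, and each
      remaining term except the viscous one is replaced by its lower bound.\<close>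
    using fluid solid by linarith
qed

end
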